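(* Let $R$ be a $k$-algebra such that for all $x,y\in R$, $x$ divides $y$ or $y$ divides $x$ (so in particular $R$ is local; for example a valuation ring of characteristic $p$). Let $S=\operatorname{Spec}R$ and let $G$ be a $p$-divisible group over $S$ endowed with an action of $O_F$. Then there exist adequate filtrations on the spaces $(\mathcal{E}_i)_{1\le i\le f}$.
   Context: Setting. $F/\mathbb{Q}_p$ is a finite unramified extension of degree $f$, with ring of integers $O_F$ and residue field $k=\mathbb{F}_{p^f}$. The embeddings of $F$ are identified with $\mathbb{Z}/f\mathbb{Z}$ via powers of the Frobenius $\sigma$; indices $i$ are read modulo $f$. $G$ has height $fh$. $\mathcal{E}=\bigoplus_{i=1}^f\mathcal{E}_i$ is the contravariant Dieudonné crystal of $G$ evaluated at $S$, with $O_F$ acting on $\mathcal{E}_i$ (locally free of rank $h$) through $\sigma^i$. Frobenius and Verschiebung give $F_i:\mathcal{E}_{i-1}^{(p)}\to\mathcal{E}_i$ and $V_i:\mathcal{E}_i\to\mathcal{E}_{i-1}^{(p)}$, where $(p)$ denotes the Frobenius twist. $\mathcal{F}_i=\omega_{G,i}\subset\mathcal{E}_i$ is the Hodge filtration, of rank $d_i$ (where $\omega_G=\bigoplus_i\omega_{G,i}$). Put $\widetilde{\mathcal{F}}_i=\ker V_i=\operatorname{Im}F_i$; also $\mathcal{F}_{i-1}^{(p)}=\operatorname{Im}V_i=\ker F_i$. Let $\delta_1<\dots<\delta_r$ be the distinct elements of $\{d_i\}\cap[1,h-1]$, $\delta_0=0$, $\delta_{r+1}=h$, and define $s(i)\in\{0,\dots,r+1\}$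 by $d_i=\delta_{s(i)}$. Adequate filtrations. These consist, for each $i$, of a filtration $$0\subset\mathcal{F}_i^{[s(i)-1]}\subset\dots\subset\mathcal{F}_i^{[1]}\subset\mathcal{F}_i\subset\mathcal{F}_i^{[r]}\subset\dots\subset\mathcal{F}_i^{[s(i)+1]}\subset\mathcal{E}_i$$ (only indices $1\le j\le r$ occur) with each $\mathcal{F}_i^{[j]}$ locally a direct factor of $\mathcal{E}_i$, of rank $d_i-\delta_j$ if $1\le j\le s(i)-1$ and of rank $h+d_i-\delta_j$ if $s(i)+1\le j\le r$. Set $\mathcal{F}_i^{[s(i)]}:=0$. Define $\widetilde{\mathcal{F}}_i^{[j]}:=V_i^{-1}((\mathcal{F}_{i-1}^{[j]})^{(p)})$ for $1\le j\le s(i-1)$ and $\widetilde{\mathcal{F}}_i^{[j]}:=F_i((\mathcal{F}_{i-1}^{[j]})^{(p)})$ for $s(i-1)+1\le j\le r$. The filtrations are required to satisfy, for all $i$: $\mathcal{F}_i^{[j]}\subset\widetilde{\mathcal{F}}_i^{[j]}$ for $1\le j\le s(i)-1$, and $\widetilde{\mathcal{F}}_i^{[j]}\subset\mathcal{F}_i^{[j]}$ for $s(i)+1\le j\le r$. *)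

theory Defs
  imports Complex_Main "HOL-Computational_Algebra.Primes"
begin

section \<open>The ring of integers of an unramified extension\<close>

text \<open>
  The ring of integers of the unramified extension of degree \<open>f\<close> of the \<open>p\<close>-adic numbers is, up to
  isomorphism, the only complete discrete valuation ring of characteristic 0 in which \<open>p\<close> is a
  uniformizer and whose residue field has \<open>p ^ f\<close> elements. The type \<open>'o\<close> is required to be
  such a ring.
\<close>

definition unramified_integers :: "nat \<Rightarrow> nat \<Rightarrow> 'o::{idom,ring_char_0} itself \<Rightarrow> bool" where
  "unramified_integers p f _ \<longleftrightarrow>
     \<not> (of_nat p :: 'o) dvd 1 \<and>
     (\<forall>a::'o. a \<noteq> 0 \<longrightarrow> (\<exists>n u. u dvd 1 \<and> a = u * of_nat p ^ n)) \<and>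
     (\<forall>s::nat \<Rightarrow> 'o. (\<forall>n. of_nat p ^ n dvd s (Suc n) - s n) \<longrightarrow>
        (\<exists>l. \<forall>n. of_nat p ^ n dvd s n - l)) \<and>
     card ((UNIV::'o set) // {(a, b). of_nat p dvd a - b}) = p ^ f"

text \<open>
  Since the residue field is the quotient of \<open>'o\<close> by \<open>p\<close>, a structure of algebra over the residue
  field on a ring \<open>'r\<close> is the same as a ring homomorphism from \<open>'o\<close> to \<open>'r\<close> killing \<open>p\<close>.
\<close>

definition residue_field_algebra :: "nat \<Rightarrow> ('o::comm_ring_1 \<Rightarrow> 'r::comm_ring_1) \<Rightarrow> bool" where
  "residue_field_algebra p \<phi> \<longleftrightarrow>
     \<phi> 1 = 1 \<and> (\<forall>a b. \<phi> (a + b) = \<phi> a + \<phi> b) \<and> (\<forall>a b. \<phi> (a * b) = \<phi> a * \<phi> b) \<and>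
     \<phi> (of_nat p) = 0"

section \<open>Free modules and direct factors\<close>

text \<open>
  All modules below live over a local ring \<open>R\<close>. The only open subset of \<open>Spec R\<close> containing
  the closed point is \<open>Spec R\<close> itself, so a submodule that is locally free (resp. locally a direct
  factor) is free (resp. a direct factor).
\<close>

definition is_basis ::
  "('r::comm_ring_1 \<Rightarrow> 'e::ab_group_add \<Rightarrow> 'e) \<Rightarrow> 'e set \<Rightarrow> 'e set \<Rightarrow> bool" where
  "is_basis sE M B \<longleftrightarrow> \<not> module.dependent sE B \<and> module.span sE B = M"

definition free_of_rank ::
  "('r::comm_ring_1 \<Rightarrow> 'e::ab_group_add \<Rightarrow> 'e) \<Rightarrow> 'e set \<Rightarrow> nat \<Rightarrow> bool" where
  "free_of_rank sE M n \<longleftrightarrow> (\<exists>B. finite B \<and> card B = n \<and> is_basis sE M B)"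

definition free_rank ::
  "('r::comm_ring_1 \<Rightarrow> 'e::ab_group_add \<Rightarrow> 'e) \<Rightarrow> 'e set \<Rightarrow> nat" where
  "free_rank sE M = (THE n. free_of_rank sE M n)"

definition direct_factor ::
  "('r::comm_ring_1 \<Rightarrow> 'e::ab_group_add \<Rightarrow> 'e) \<Rightarrow> 'e set \<Rightarrow> 'e set \<Rightarrow> bool" where
  "direct_factor sE M E \<longleftrightarrow> module.subspace sE M \<and>
     (\<exists>N. module.subspace sE N \<and> M \<inter> N = {0} \<and> {x + y |x y. x \<in> M \<and> y \<in> N} = E)"

text \<open>
  \<open>frobenius_twist p sE sT \<tau>\<close>: the module \<open>T\<close>, with the map \<open>\<tau> x = 1 \<otimes> x\<close>, is the base change of the
  free module \<open>E\<close> along the \<open>p\<close>-th power Frobenius endomorphism of the base ring, that is, \<open>\<tau>\<close> is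
  Frobenius-semilinear and takes a basis of \<open>E\<close> to a basis of \<open>T\<close>. (This then
  holds for every basis of \<open>E\<close>.) If \<open>M\<close> is a direct factor of \<open>E\<close>, its twist is the submodule
  spanned by \<open>\<tau> ` M\<close>, and the twist of an endomorphism \<open>g\<close> of \<open>E\<close> is the unique endomorphism \<open>g'\<close>
  of \<open>T\<close> with \<open>g' (\<tau> x) = \<tau> (g x)\<close>.
\<close>

definition frobenius_twist ::
  "nat \<Rightarrow> ('r::comm_ring_1 \<Rightarrow> 'e::ab_group_add \<Rightarrow> 'e) \<Rightarrow> ('r \<Rightarrow> 't::ab_group_add \<Rightarrow> 't)
     \<Rightarrow> ('e \<Rightarrow> 't) \<Rightarrow> bool" where
  "frobenius_twist p sE sT \<tau> \<longleftrightarrow>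
     (\<forall>x y. \<tau> (x + y) = \<tau> x + \<tau> y) \<and> (\<forall>a x. \<tau> (sE a x) = sT (a ^ p) (\<tau> x)) \<and>
     (\<exists>B. is_basis sE UNIV B \<and> inj_on \<tau> B \<and> is_basis sT UNIV (\<tau> ` B))"

section \<open>Dieudonne crystals evaluated at the base\<close>

text \<open>
  The (contravariant) Dieudonne crystal of a \<open>p\<close>-divisible group of height \<open>n\<close>, evaluated at
  the base \<open>Spec R\<close> with \<open>R\<close> local of characteristic \<open>p\<close>: a free module \<open>E\<close> of rank \<open>n\<close> (the
  type \<open>'e\<close>), its Frobenius twist \<open>T\<close> (the type \<open>'t\<close>), the linear maps \<open>F: T \<rightarrow> E\<close> and
  \<open>V: E \<rightarrow> T\<close> given by Frobenius and Verschiebung, and the Hodge filtration \<open>\<omega>\<close>.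
\<close>

locale dieudonne_evaluation =
  E: module sE + T: module sT + F: module_hom sT sE F + V: module_hom sE sT V
  for sE :: "'r::comm_ring_1 \<Rightarrow> 'e::ab_group_add \<Rightarrow> 'e"
    and sT :: "'r \<Rightarrow> 't::ab_group_add \<Rightarrow> 't"
    and F :: "'t \<Rightarrow> 'e" and V :: "'e \<Rightarrow> 't" +
  fixes p n :: nat and \<tau> :: "'e \<Rightarrow> 't" and \<omega> :: "'e set"
  assumes E_free: "free_of_rank sE UNIV n"
    and T_twist: "frobenius_twist p sE sT \<tau>"
    and hodge_direct_factor: "direct_factor sE \<omega> UNIV"
    and ker_V: "{x. V x = 0} = range F"
    and ker_F: "{y. F y = 0} = range V"
    and hodge_twist: "range V = T.span (\<tau> ` \<omega>)"

text \<open>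
  The same with the action of the ring of integers \<open>'o\<close> induced by an action on the group: \<open>act\<close> is
  an action on \<open>E\<close> by linear endomorphisms, it preserves the Hodge filtration, and \<open>F\<close> and \<open>V\<close> are
  equivariant, with \<open>T\<close> acted upon through the twists \<open>g\<close> of the endomorphisms \<open>act a\<close>.
  The height is \<open>f * h\<close>.
\<close>

locale dieudonne_evaluation_action =
  dieudonne_evaluation sE sT F V p "f * h" \<tau> \<omega> + A: module act
  for sE :: "'r::comm_ring_1 \<Rightarrow> 'e::ab_group_add \<Rightarrow> 'e"
    and sT :: "'r \<Rightarrow> 't::ab_group_add \<Rightarrow> 't"
    and F :: "'t \<Rightarrow> 'e" and V :: "'e \<Rightarrow> 't"
    and p f h :: nat and \<tau> :: "'e \<Rightarrow> 't" and \<omega> :: "'e set"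
    and act :: "'o::comm_ring_1 \<Rightarrow> 'e \<Rightarrow> 'e" +
  fixes \<phi> :: "'o \<Rightarrow> 'r"
  assumes act_linear: "act a (sE c x) = sE c (act a x)"
    and act_hodge: "x \<in> \<omega> \<Longrightarrow> act a x \<in> \<omega>"
    and act_F: "\<lbrakk>module_hom sT sT g; \<And>x. g (\<tau> x) = \<tau> (act a x)\<rbrakk> \<Longrightarrow> F (g y) = act a (F y)"
    and act_V: "\<lbrakk>module_hom sT sT g; \<And>x. g (\<tau> x) = \<tau> (act a x)\<rbrakk> \<Longrightarrow> V (act a x) = g (V x)"
begin

text \<open>
  The classes of integers modulo \<open>f\<close> are represented by the indices \<open>i < f\<close>, and \<open>pred_idx i\<close>
  represents \<open>i - 1\<close>.
\<close>

definition pred_idx :: "nat \<Rightarrow> nat" where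
  "pred_idx i = (if i = 0 then f - 1 else i - 1)"

text \<open>
  The part of \<open>E\<close> where the action is through \<open>\<sigma> ^ i\<close>. As \<open>\<sigma>\<close> lifts the \<open>p\<close>-th power map of the
  residue field, \<open>\<phi> (\<sigma> ^ i a) = \<phi> a ^ (p ^ i)\<close>.
\<close>

definition part :: "nat \<Rightarrow> 'e set" where
  "part i = {x. \<forall>a. act a x = sE (\<phi> a ^ (p ^ i)) x}"

definition hodge :: "nat \<Rightarrow> 'e set" where
  "hodge i = \<omega> \<inter> part i"

definition d :: "nat \<Rightarrow> nat" where
  "d i = free_rank sE (hodge i)"

definition \<Delta> :: "nat set" where
  "\<Delta> = d ` {..<f} \<inter> {1..h - 1}"

definition r :: nat where
  "r = card \<Delta>"

definition \<delta> :: "nat \<Rightarrow> nat" where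
  "\<delta> j = (0 # sorted_list_of_set \<Delta> @ [h]) ! j"

definition s :: "nat \<Rightarrow> nat" where
  "s i = (THE j. j \<le> r + 1 \<and> \<delta> j = d i)"

text \<open>
  A family of filtrations is given by the submodules \<open>Fil i j\<close> for \<open>i < f\<close>, \<open>1 \<le> j \<le> r\<close> and
  \<open>j \<noteq> s i\<close>; all other values of \<open>Fil\<close> are irrelevant. The convention that the submodule of
  index \<open>s i\<close> vanishes is built into \<open>step\<close>, and \<open>tilde\<close> is the pullback under \<open>V\<close> or the
  image under \<open>F\<close> of the twisted submodule of index \<open>i - 1\<close>.
\<close>

definition step :: "(nat \<Rightarrow> nat \<Rightarrow> 'e set) \<Rightarrow> nat \<Rightarrow> nat \<Rightarrow> 'e set" where
  "step Fil i j = (if j = s i then {0} else Fil i j)"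

definition tilde :: "(nat \<Rightarrow> nat \<Rightarrow> 'e set) \<Rightarrow> nat \<Rightarrow> nat \<Rightarrow> 'e set" where
  "tilde Fil i j =
     (if j \<le> s (pred_idx i)
      then {x \<in> part i. V x \<in> T.span (\<tau> ` step Fil (pred_idx i) j)}
      else F ` T.span (\<tau> ` step Fil (pred_idx i) j))"

definition adequate :: "(nat \<Rightarrow> nat \<Rightarrow> 'e set) \<Rightarrow> bool" where
  "adequate Fil \<longleftrightarrow> (\<forall>i<f.
     (\<forall>j\<in>{1..r}. j < s i \<longrightarrow>
        direct_factor sE (Fil i j) (part i) \<and> free_of_rank sE (Fil i j) (d i - \<delta> j) \<and>
        Fil i j \<subseteq> hodge i \<and> Fil i j \<subseteq> tilde Fil i j) \<and>
     (\<forall>j\<in>{1..r}. s i < j \<longrightarrow>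
        direct_factor sE (Fil i j) (part i) \<and> free_of_rank sE (Fil i j) (h + d i - \<delta> j) \<and>
        hodge i \<subseteq> Fil i j \<and> tilde Fil i j \<subseteq> Fil i j) \<and>
     (\<forall>j\<in>{1..r}. \<forall>j'\<in>{1..r}. j \<le> j' \<and> (j' < s i \<or> s i < j) \<longrightarrow> Fil i j' \<subseteq> Fil i j))"

end

end

theory Submission
  imports Defs "HOL-Computational_Algebra.Polynomial"
begin

text \<open>
  Over a ring in which divisibility is total, pivoting on a coefficient dividing all the others shows
  that, in a free module of finite rank, the intersection of two direct factors contains a direct
  factor of the expected rank, and that a direct factor can be enlarged by one in rank so as to
  contain any given vector.

  For each \<open>j\<close> the submodules of index \<open>j\<close> are built by going once round the cycle of
  embeddings, starting after an index \<open>i\<close> with \<open>s i = j\<close>, where nothing is required. Whatever the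
  position of \<open>j\<close> relative to \<open>s (i - 1)\<close>, the tilde submodule at \<open>i\<close> is a direct factor of rank
  \<open>h - \<delta> j\<close>. For \<open>j < s i\<close> the next submodule is found inside the intersection of the tilde
  submodule with the submodule of index \<open>j - 1\<close>, the ambient module being the tilde submodule of
  index \<open>j - 1\<close>; for \<open>j > s i\<close> it is found between the sum of the tilde submodule with the Hodge
  filtration and the submodule of index \<open>j - 1\<close>, or the whole part if \<open>s i = j - 1\<close>. The Hodge
  filtration serves as submodule of index 0.

  The projections onto the parts of the Dieudonne module are sums over the residue field, and \<open>F\<close>
  and \<open>V\<close> show that the ranks of the parts decrease weakly along the cycle, hence are all \<open>h\<close>.
\<close>

section \<open>Direct factors of modules over a ring with total divisibility\<close>

text \<open>Total divisibility is a total preorder, so finite families of ring elements have a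
  minimum. It serves as pivot in the eliminations below.\<close>

lemma finite_chain_has_divisor:
  fixes g :: "'a \<Rightarrow> 'r::comm_ring_1"
  assumes "finite A" "A \<noteq> {}" and chain: "\<And>x y :: 'r. x dvd y \<or> y dvd x"
  shows "\<exists>a\<in>A. \<forall>b\<in>A. g a dvd g b"
  using assms(1,2)
proof (induction rule: finite_ne_induct)
  case (insert x F)
  then show ?case using chain by (metis dvd_trans insert_iff dvd_refl)
qed auto

section \<open>Direct factors over a commutative ring\<close>

context module
begin

text \<open>Coordinates in an independent set are unique, so those of a vector in both spans vanish
  outside \<open>X\<close> and outside \<open>Y\<close>.\<close>

lemma span_Int_independent:
  assumes "independent (X \<union> Y)"
  shows "span X \<inter> span Y = span (X \<inter> Y)"
proof
  show "span X \<inter> span Y \<subseteq> span (X \<inter> Y)"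
  proof
    fix v assume v: "v \<in> span X \<inter> span Y"
    let ?R = "representation (X \<union> Y) v"
    have "?R = representation X v" "?R = representation Y v"
      using v assms by (auto intro!: representation_extend)
    then have "b \<in> X \<inter> Y" if "?R b \<noteq> 0" for b
      using that representation_ne_zero[of X v b] representation_ne_zero[of Y v b] by simp
    then have "(\<Sum>b | ?R b \<noteq> 0. ?R b *s b) \<in> span (X \<inter> Y)"
      by (auto intro!: span_sum span_scale intro: span_base)
    moreover have "(\<Sum>b | ?R b \<noteq> 0. ?R b *s b) = v"
      using v assms span_mono[of X "X \<union> Y"]
      by (intro sum_nonzero_representation_eq) auto
    ultimately show "v \<in> span (X \<inter> Y)" by simp
  qed
qed (simp add: span_mono)

lemma direct_factorI:
  assumes "subspace M" "subspace N" "M \<inter> N = {0}" "M \<subseteq> P" "N \<subseteq> P" "subspace P"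
    "\<And>x. x \<in> P \<Longrightarrow> \<exists>y\<in>M. x - y \<in> N"
  shows "direct_factor scale M P"
  unfolding direct_factor_def
proof (intro conjI exI)
  show "{x + y |x y. x \<in> M \<and> y \<in> N} = P"
  proof safe
    fix x assume "x \<in> P"
    then show "\<exists>xa y. x = xa + y \<and> xa \<in> M \<and> y \<in> N"
      using assms(7) by (metis add_diff_cancel_left' diff_add_cancel add.commute)
  qed (use assms subspace_add in blast)
qed fact+

lemma direct_factorE:
  assumes "direct_factor scale M P"
  obtains N where "subspace M" "subspace N" "M \<inter> N = {0}" "M \<subseteq> P" "N \<subseteq> P" "subspace P"
    "\<And>x. x \<in> P \<Longrightarrow> \<exists>y\<in>M. x - y \<in> N"
proof -
  obtain N where M: "subspace M" and N: "subspace N" "M \<inter> N = {0}"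
    and P: "{x + y |x y. x \<in> M \<and> y \<in> N} = P"
    using assms by (auto simp: direct_factor_def)
  have "P = span (M \<union> N)"
    unfolding span_Un using M N P by (simp flip: span_eq_iff)
  moreover have "\<exists>y\<in>M. x - y \<in> N" if "x \<in> P" for x
    using that unfolding P[symmetric] by force
  ultimately show ?thesis
    using that[OF M N] span_superset[of "M \<union> N"] by auto
qed

lemma direct_factor_subset: "direct_factor scale M P \<Longrightarrow> M \<subseteq> P"
  by (elim direct_factorE)

lemma direct_factor_subspace: "direct_factor scale M P \<Longrightarrow> subspace M"
  by (elim direct_factorE)

lemma direct_factor_zero: "subspace P \<Longrightarrow> direct_factor scale {0} P"
  by (rule direct_factorI[where N = P]) (auto simp: subspace_0)

lemma direct_factor_refl: "subspace P \<Longrightarrow> direct_factor scale P P"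
  by (rule direct_factorI[where N = "{0}"]) (auto simp: subspace_0)

text \<open>If \<open>N\<close> complements \<open>L\<close> in \<open>M\<close> and
  \<open>Q\<close> complements \<open>M\<close> in \<open>P\<close>, then \<open>N + Q\<close>
  complements \<open>L\<close> in \<open>P\<close>.\<close>

lemma direct_factor_trans:
  assumes "direct_factor scale L M" "direct_factor scale M P"
  shows "direct_factor scale L P"
proof -
  obtain N where N: "subspace L" "subspace N" "L \<inter> N = {0}" "L \<subseteq> M" "N \<subseteq> M"
    "\<And>x. x \<in> M \<Longrightarrow> \<exists>y\<in>L. x - y \<in> N"
    using assms(1) by (elim direct_factorE) blast
  obtain Q where Q: "subspace M" "subspace Q" "M \<inter> Q = {0}" "M \<subseteq> P" "Q \<subseteq> P" "subspace P"
    "\<And>x. x \<in> P \<Longrightarrow> \<exists>y\<in>M. x - y \<in> Q"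
    using assms(2) by (elim direct_factorE) blast
  have sp: "span (N \<union> Q) = {x + y |x y. x \<in> N \<and> y \<in> Q}"
    unfolding span_Un using N Q by (simp flip: span_eq_iff)
  show ?thesis
  proof (rule direct_factorI[where N = "span (N \<union> Q)"])
    show "L \<inter> span (N \<union> Q) = {0}"
    proof -
      have "z = 0" if "z \<in> L" "z = x + y" "x \<in> N" "y \<in> Q" for x y z
      proof -
        have "y = z - x" using that by simp
        moreover have "z - x \<in> M" using that N Q by (intro subspace_diff) auto
        ultimately have "y = 0" using that Q by blast
        then show ?thesis using that N by auto
      qed
      then have "L \<inter> span (N \<union> Q) \<subseteq> {0}" unfolding sp by blast
      then show ?thesis using N(1) subspace_0 span_zero by blast
    qed
    show "span (N \<union> Q) \<subseteq> P" using N Q by (intro span_minimal) auto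
    show "\<exists>y\<in>L. x - y \<in> span (N \<union> Q)" if x: "x \<in> P" for x
    proof -
      obtain m where m: "m \<in> M" "x - m \<in> Q" using Q(7)[OF x] by blast
      obtain l where l: "l \<in> L" "m - l \<in> N" using N(6)[OF m(1)] by blast
      have "x - l = (m - l) + (x - m)" by simp
      then show ?thesis using l m unfolding sp by blast
    qed
  qed (use N Q in auto)
qed

text \<open>Modular law: a complement \<open>N\<close> of \<open>M\<close> in \<open>P\<close> cuts
  out the complement \<open>N \<inter> L\<close> of \<open>M\<close> in \<open>L\<close>.\<close>

lemma direct_factor_between:
  assumes "direct_factor scale M P" "M \<subseteq> L" "subspace L" "L \<subseteq> P"
  shows "direct_factor scale M L"
proof -
  obtain N where N: "subspace M" "subspace N" "M \<inter> N = {0}" "M \<subseteq> P" "N \<subseteq> P" "subspace P"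
    "\<And>x. x \<in> P \<Longrightarrow> \<exists>y\<in>M. x - y \<in> N"
    using assms(1) by (elim direct_factorE) blast
  show ?thesis
  proof (rule direct_factorI[where N = "N \<inter> L"])
    show "\<exists>y\<in>M. x - y \<in> N \<inter> L" if "x \<in> L" for x
      using N(7)[of x] that assms by (auto intro: subspace_diff)
  qed (use N assms subspace_0 in \<open>auto intro: subspace_inter\<close>)
qed

lemma direct_factor_retraction:
  assumes "subspace M" "subspace P" "M \<subseteq> P"
    and add: "\<And>x y. x \<in> P \<Longrightarrow> y \<in> P \<Longrightarrow> \<rho> (x + y) = \<rho> x + \<rho> y"
    and scale: "\<And>c x. x \<in> P \<Longrightarrow> \<rho> (c *s x) = c *s \<rho> x"
    and "\<And>x. x \<in> P \<Longrightarrow> \<rho> x \<in> M" and id: "\<And>x. x \<in> M \<Longrightarrow> \<rho> x = x"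
  shows "direct_factor scale M P"
proof (rule direct_factorI[where N = "{x \<in> P. \<rho> x = 0}"])
  have 0: "\<rho> 0 = 0" using id subspace_0 assms by blast
  show "subspace {x \<in> P. \<rho> x = 0}"
    using assms 0 by (auto simp: subspace_def)
  show "M \<inter> {x \<in> P. \<rho> x = 0} = {0}"
    using assms 0 subspace_0 by auto
  show "\<exists>y\<in>M. x - y \<in> {x \<in> P. \<rho> x = 0}" if "x \<in> P" for x
  proof
    have "\<rho> x \<in> P" using that assms by auto
    then have P: "\<rho> x \<in> P" "x - \<rho> x \<in> P"
      using that assms subspace_diff[of P x "\<rho> x"] by auto
    have "\<rho> (x - \<rho> x) + \<rho> (\<rho> x) = \<rho> x"
      using P by (subst add[symmetric]) auto
    then show "x - \<rho> x \<in> {x \<in> P. \<rho> x = 0}"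
      using that P assms by auto
  qed (use that assms in auto)
qed (use assms in auto)

lemma direct_factor_projection:
  assumes "direct_factor scale M P"
  shows "\<exists>\<pi>. (\<forall>x\<in>P. \<forall>y\<in>P. \<pi> (x + y) = \<pi> x + \<pi> y) \<and> (\<forall>c. \<forall>x\<in>P. \<pi> (c *s x) = c *s \<pi> x) \<and>
    (\<forall>x\<in>P. \<pi> x \<in> M) \<and> (\<forall>x\<in>M. \<pi> x = x)"
proof -
  obtain N where N: "subspace M" "subspace N" "M \<inter> N = {0}" "M \<subseteq> P" "N \<subseteq> P" "subspace P"
    "\<And>x. x \<in> P \<Longrightarrow> \<exists>y\<in>M. x - y \<in> N"
    using assms by (elim direct_factorE) blast
  then obtain \<pi> where \<pi>: "\<And>x. x \<in> P \<Longrightarrow> \<pi> x \<in> M" "\<And>x. x \<in> P \<Longrightarrow> x - \<pi> x \<in> N" by metis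
  have uniq: "\<pi> x = y" if "x \<in> P" "y \<in> M" "x - y \<in> N" for x y
  proof -
    have "\<pi> x - y \<in> M" using N(1) \<pi>(1) that by (intro subspace_diff) auto
    moreover have "(x - y) - (x - \<pi> x) \<in> N"
      using that \<pi>(2)[of x] by (intro subspace_diff[OF N(2), of "x - y" "x - \<pi> x"])
    ultimately have "\<pi> x - y \<in> M \<inter> N" by simp
    then show ?thesis using N by auto
  qed
  show ?thesis
  proof (intro exI conjI ballI allI)
    show "\<pi> (x + y) = \<pi> x + \<pi> y" if "x \<in> P" "y \<in> P" for x y
    proof (rule uniq)
      have "(x - \<pi> x) + (y - \<pi> y) \<in> N" using N \<pi> that by (intro subspace_add) auto
      then show "x + y - (\<pi> x + \<pi> y) \<in> N" by (simp add: algebra_simps)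
    qed (use N \<pi> that in \<open>auto intro: subspace_add\<close>)
    show "\<pi> (c *s x) = c *s \<pi> x" if "x \<in> P" for c x
    proof (rule uniq)
      have "c *s (x - \<pi> x) \<in> N" using N \<pi> that by (intro subspace_scale) auto
      then show "c *s x - c *s \<pi> x \<in> N" by (simp add: scale_right_diff_distrib)
    qed (use N \<pi> that in \<open>auto intro: subspace_scale\<close>)
    show "\<pi> x = x" if "x \<in> M" for x
      using that N subspace_0 by (intro uniq) auto
  qed (use \<pi> in auto)
qed

lemma direct_factor_span:
  assumes "independent (A \<union> C)" "A \<inter> C = {}"
  shows "direct_factor scale (span A) (span (A \<union> C))"
proof (rule direct_factorI[where N = "span C"])
  show "span A \<inter> span C = {0}"
    using assms span_Int_independent by auto
  show "\<exists>y\<in>span A. x - y \<in> span C" if "x \<in> span (A \<union> C)" for x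
    using that by (force simp: span_Un)
qed (auto intro: span_mono[THEN subsetD])

end

section \<open>Bases and ranks over a ring with total divisibility\<close>

locale chain_module = module scale
  for scale :: "'r::comm_ring_1 \<Rightarrow> 'e::ab_group_add \<Rightarrow> 'e" (infixr \<open>*s\<close> 75) +
  assumes chain: "x dvd y \<or> y dvd (x::'r)"
begin

text \<open>A unit coordinate at \<open>b\<close> allows \<open>b\<close> to be solved for in terms
  of \<open>x\<close> and the rest of \<open>B\<close>.\<close>

lemma exchange:
  assumes B: "independent B" "finite B" and x: "x \<in> span B" and b: "b \<in> B"
    and unit: "representation B x b dvd 1"
  shows "is_basis scale (span B) (insert x (B - {b}))" "x \<notin> B - {b}"
proof -
  let ?R = "representation B"
  obtain u where u: "1 = ?R x b * u" using unit by (auto simp: dvd_def)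
  show nin: "x \<notin> B - {b}"
  proof
    assume "x \<in> B - {b}"
    then show False using unit representation_basis[of B x] B by auto
  qed
  have "(\<Sum>v\<in>B. ?R x v *s v) = x"
    using B x by (intro sum_representation_eq) auto
  then have xeq: "x = ?R x b *s b + (\<Sum>v\<in>B - {b}. ?R x v *s v)"
    using B b by (simp add: sum.remove)
  have "b = u *s x - u *s (\<Sum>v\<in>B - {b}. ?R x v *s v)"
    using u by (subst xeq) (simp add: scale_right_distrib mult.commute)
  moreover have "\<dots> \<in> span (insert x (B - {b}))"
    by (intro span_diff span_scale span_sum) (auto intro: span_base)
  ultimately have bin: "b \<in> span (insert x (B - {b}))" by simp
  have "v \<in> span (insert x (B - {b}))" if "v \<in> B" for v
    using bin that by (cases "v = b") (auto intro: span_base)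
  then have "span (insert x (B - {b})) = span B"
    using x by (subst span_eq) (auto intro: span_base)
  moreover have "independent (insert x (B - {b}))"
  proof
    assume "dependent (insert x (B - {b}))"
    then obtain c w where w: "w \<in> insert x (B - {b})" "c w \<noteq> 0"
      and s: "(\<Sum>v\<in>insert x (B - {b}). c v *s v) = 0"
      using B by (auto simp: dependent_finite)
    have e: "c x *s x + (\<Sum>v\<in>B - {b}. c v *s v) = 0"
      using s nin B by (subst (asm) sum.insert) auto
    \<comment> \<open>At the coordinate \<open>b\<close> the relation sees only \<open>x\<close>,
      with a unit there, so the coefficient of \<open>x\<close> vanishes.\<close>
    have "?R (c x *s x + (\<Sum>v\<in>B - {b}. c v *s v)) b = c x * ?R x b + (\<Sum>v\<in>B - {b}. c v * ?R v b)"
    proof -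
      have "(\<Sum>v\<in>B - {b}. c v *s v) \<in> span B"
        by (intro span_sum span_scale span_base) auto
      moreover have "?R (\<Sum>v\<in>B - {b}. c v *s v) b = (\<Sum>v\<in>B - {b}. c v * ?R v b)"
        using B by (subst representation_sum) (simp_all add: representation_scale span_base span_scale)
      ultimately show ?thesis
        using B x by (simp add: representation_add representation_scale span_scale)
    qed
    also have "(\<Sum>v\<in>B - {b}. c v * ?R v b) = 0"
      using B by (intro sum.neutral) (auto simp: representation_basis)
    finally have "c x * ?R x b = 0" unfolding e by (simp add: representation_zero)
    then have cx: "c x = 0" using u by (metis mult.assoc mult.right_neutral mult_zero_left)
    then have "(\<Sum>v\<in>B - {b}. c v *s v) = 0" using e by simp
    then have "c v = 0" if "v \<in> B - {b}" for v
      using independentD[OF B(1), of "B - {b}" c v] B that by auto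
    then show False using w cx by auto
  qed
  ultimately show "is_basis scale (span B) (insert x (B - {b}))"
    by (simp add: is_basis_def)
qed

text \<open>A basis vector \<open>b\<close> outside \<open>S\<close> is a combination of vectors of
  \<open>S\<close> whose contributions to the coordinate at \<open>b\<close> sum to 1. A
  contribution dividing all others is then a unit, and the corresponding vector of \<open>S\<close>
  replaces \<open>b\<close>.\<close>

lemma steinitz:
  assumes "finite B" "is_basis scale P B" and S: "span S = P"
  shows "\<exists>B'\<subseteq>S. finite B' \<and> card B' = card B \<and> is_basis scale P B'"
  using assms(1,2)
proof (induction "card (B - S)" arbitrary: B rule: less_induct)
  case less
  show ?case
  proof (cases "B \<subseteq> S")
    case False
    then obtain b where b: "b \<in> B" "b \<notin> S" by blast
    have B: "independent B" "span B = P"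
      using less.prems by (auto simp: is_basis_def)
    then have "b \<in> span S" using b S by (auto intro: span_base)
    then obtain t r where t: "finite t" "t \<subseteq> S" "b = (\<Sum>a\<in>t. r a *s a)"
      by (auto simp: span_explicit)
    have tB: "a \<in> span B" if "a \<in> t" for a
      using that t S B span_base by blast
    let ?g = "\<lambda>a. r a * representation B a b"
    have one: "1 = (\<Sum>a\<in>t. ?g a)"
    proof -
      have "1 = representation B b b" using B b by (simp add: representation_basis)
      also have "\<dots> = (\<Sum>a\<in>t. ?g a)"
        unfolding t(3) using B tB
        by (subst representation_sum) (auto simp: representation_scale span_scale)
      finally show ?thesis .
    qed
    then have "t \<noteq> {}" by auto
    then obtain a where a: "a \<in> t" "\<forall>a'\<in>t. ?g a dvd ?g a'"
      using finite_chain_has_divisor[of t ?g] t chain by blast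
    then have "?g a dvd 1"
      unfolding one by (intro dvd_sum) auto
    then have unit: "representation B a b dvd 1"
      using dvd_mult_right by blast
    have aS: "a \<in> S" using a t by auto
    have anB: "a \<notin> B - {b}" "a \<noteq> b" "is_basis scale P (insert a (B - {b}))"
      using exchange[OF B(1) less.prems(1) tB[OF a(1)] b(1) unit] B b aS by auto
    have "insert a (B - {b}) - S = (B - S) - {b}" using aS by auto
    then have "card (insert a (B - {b}) - S) < card (B - S)"
      using b less.prems by (metis DiffI card_Diff1_less finite_Diff)
    moreover have "card (insert a (B - {b})) = card B"
      using anB b less.prems by (metis card.insert card.remove finite_Diff)
    ultimately show ?thesis
      using less.hyps[of "insert a (B - {b})"] less.prems anB by auto
  qed (use less.prems in auto)
qed

lemma basis_finite_card:
  assumes "free_of_rank scale P n" "is_basis scale P B"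
  shows "finite B" "card B = n"
proof -
  obtain B0 where "finite B0" "card B0 = n" "is_basis scale P B0"
    using assms by (auto simp: free_of_rank_def)
  then obtain B' where B': "B' \<subseteq> B" "finite B'" "card B' = n" "is_basis scale P B'"
    using steinitz[of B0 P B] assms by (auto simp: is_basis_def)
  then have "B = B'"
    using assms spanning_subset_independent[of B' B] by (auto simp: is_basis_def intro: span_base)
  then show "finite B" "card B = n" using B' by auto
qed

lemma free_of_rank_unique:
  "free_of_rank scale P n \<Longrightarrow> free_of_rank scale P m \<Longrightarrow> n = m"
  using basis_finite_card by (metis free_of_rank_def)

lemma free_rank_eq: "free_of_rank scale P n \<Longrightarrow> free_rank scale P = n"
  unfolding free_rank_def using free_of_rank_unique by blast

text \<open>This turns counting into independence: such a set contains a basis, which exhausts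
  it.\<close>

lemma spanning_card_le_basis:
  assumes "free_of_rank scale P n" "finite S" "span S = P" "card S \<le> n"
  shows "is_basis scale P S" "card S = n"
proof -
  obtain B0 where "finite B0" "card B0 = n" "is_basis scale P B0"
    using assms by (auto simp: free_of_rank_def)
  then obtain B' where B': "B' \<subseteq> S" "card B' = n" "is_basis scale P B'"
    using steinitz[of B0 P S] assms by auto
  then have "B' = S" using assms by (simp add: card_seteq)
  then show "is_basis scale P S" "card S = n" using B' by auto
qed

text \<open>A direct factor and its complement span together, so a basis can be picked from their
  union; its members in \<open>M\<close> span \<open>M\<close>. In particular direct factors of free
  modules of finite rank are free.\<close>

lemma direct_factor_bases:
  assumes df: "direct_factor scale M P" and P: "free_of_rank scale P n"
  obtains A C where "finite A" "finite C" "A \<inter> C = {}" "is_basis scale M A"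
    "is_basis scale P (A \<union> C)" "card A + card C = n"
proof -
  obtain N where N: "subspace M" "subspace N" "M \<inter> N = {0}" "M \<subseteq> P" "N \<subseteq> P" "subspace P"
    "\<And>x. x \<in> P \<Longrightarrow> \<exists>y\<in>M. x - y \<in> N"
    using df by (elim direct_factorE) blast
  obtain B0 where B0: "finite B0" "card B0 = n" "is_basis scale P B0"
    using P by (auto simp: free_of_rank_def)
  have "span (M \<union> N) = P"
  proof
    show "P \<subseteq> span (M \<union> N)"
    proof
      fix x assume "x \<in> P"
      then obtain y where "y \<in> M" "x - y \<in> N" using N by blast
      then have "y + (x - y) \<in> span (M \<union> N)" by (intro span_add span_base) auto
      then show "x \<in> span (M \<union> N)" by simp
    qed
  qed (use N span_minimal[of "M \<union> N" P] in auto)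
  then obtain B where B: "B \<subseteq> M \<union> N" "finite B" "card B = n" "is_basis scale P B"
    using steinitz[OF B0(1,3), of "M \<union> N"] B0 by auto
  let ?A = "B \<inter> M" and ?C = "B - M"
  have sA: "span ?A \<subseteq> M" and sC: "span ?C \<subseteq> N"
    using N B by (intro span_minimal; auto)+
  have AC: "?A \<union> ?C = B" by auto
  have ind: "independent B" "span B = P" using B by (auto simp: is_basis_def)
  have "M \<subseteq> span ?A"
  proof
    fix x assume x: "x \<in> M"
    then have "x \<in> span (?A \<union> ?C)" unfolding AC using ind N by auto
    then obtain a c where ac: "x = a + c" "a \<in> span ?A" "c \<in> span ?C"
      by (auto simp: span_Un)
    then have "c = x - a" by simp
    moreover have "x - a \<in> M" using ac sA x N by (intro subspace_diff) auto
    ultimately have "c \<in> M \<inter> N" using ac sC by auto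
    then show "x \<in> span ?A" using N ac by auto
  qed
  then have "is_basis scale M ?A"
    using sA ind independent_mono[of B ?A] by (auto simp: is_basis_def)
  moreover have "card ?A + card ?C = n"
    using B by (subst card_Un_disjoint[symmetric]) (auto simp: AC)
  ultimately show ?thesis
    using that[of ?A ?C] B AC by auto
qed

lemma direct_factor_extend_basis:
  assumes df: "direct_factor scale M P" and P: "free_of_rank scale P n" and A: "is_basis scale M A"
  obtains C where "finite A" "finite C" "A \<inter> C = {}" "is_basis scale P (A \<union> C)" "card A + card C = n"
proof -
  obtain A' C where A': "finite A'" "finite C" "A' \<inter> C = {}" "is_basis scale M A'"
    "is_basis scale P (A' \<union> C)" "card A' + card C = n"
    using direct_factor_bases[OF df P] .
  have fA: "finite A" "card A = card A'"
    using basis_finite_card[of M "card A'" A] A A' by (auto simp: free_of_rank_def)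
  have sp: "span (A \<union> C) = P"
    using A A' by (simp add: span_Un is_basis_def)
  have le: "card (A \<union> C) \<le> n" using card_Un_le[of A C] fA A' by simp
  have b: "is_basis scale P (A \<union> C)" "card (A \<union> C) = n"
    using spanning_card_le_basis[OF P _ sp le] fA A' by auto
  moreover have "A \<inter> C = {}"
    using card_Un_Int[of A C] b fA A' by auto
  ultimately show ?thesis using that[of C] fA A' by auto
qed

section \<open>Direct factors of prescribed rank\<close>

lemma free_of_rank_span: "independent B \<Longrightarrow> finite B \<Longrightarrow> free_of_rank scale (span B) (card B)"
  by (auto simp: free_of_rank_def is_basis_def)

lemma free_of_rank_subspace: "free_of_rank scale M n \<Longrightarrow> subspace M"
  by (auto simp: free_of_rank_def is_basis_def)

lemma direct_factor_rank_le:
  assumes "direct_factor scale M P" "free_of_rank scale P n" "free_of_rank scale M m"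
  shows "m \<le> n"
  using direct_factor_bases[OF assms(1,2)] free_of_rank_unique[OF assms(3)] assms
  by (metis free_of_rank_def le_add1)

lemma free_of_rank_zero: "free_of_rank scale M 0 \<longleftrightarrow> M = {0}"
proof
  show "free_of_rank scale M 0" if "M = {0}"
    unfolding free_of_rank_def is_basis_def using that by (intro exI[of _ "{}"]) (simp add: independent_empty)
qed (auto simp: free_of_rank_def is_basis_def)

text \<open>Each linear form costs one in rank: subtracting multiples of the basis vector whose
  value divides all the others makes the form vanish on the rest of the basis. The common kernel may
  be larger, which is why only a submodule of it is produced.\<close>

lemma kernel_contains_direct_factor:
  assumes "finite K" "card K \<le> m" and M: "free_of_rank scale M m"
    and add: "\<And>k x y. k \<in> K \<Longrightarrow> x \<in> M \<Longrightarrow> y \<in> M \<Longrightarrow> g k (x + y) = g k x + g k y"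
    and scale: "\<And>k c x. k \<in> K \<Longrightarrow> x \<in> M \<Longrightarrow> g k (c *s x) = c * g k x"
  shows "\<exists>L. direct_factor scale L M \<and> free_of_rank scale L (m - card K) \<and> (\<forall>k\<in>K. \<forall>x\<in>L. g k x = 0)"
  using assms(1,2,4,5)
proof (induction rule: finite_induct)
  case empty
  then show ?case using M by (intro exI[of _ M]) (simp add: direct_factor_refl free_of_rank_subspace)
next
  case (insert k K)
  then obtain L where L: "direct_factor scale L M" "free_of_rank scale L (m - card K)"
    "\<forall>k\<in>K. \<forall>x\<in>L. g k x = 0"
    by (metis Suc_leD card_insert_disjoint insertCI)
  have LM: "L \<subseteq> M" using L direct_factor_subset by blast
  obtain A where A: "finite A" "card A = m - card K" "independent A" "span A = L"
    using L by (auto simp: free_of_rank_def is_basis_def)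
  have "A \<noteq> {}" using A insert by auto
  then obtain a where a: "a \<in> A" "\<forall>b\<in>A. g k a dvd g k b"
    using finite_chain_has_divisor[OF A(1)] chain by blast
  then obtain \<mu> where \<mu>: "\<And>b. b \<in> A \<Longrightarrow> g k b = g k a * \<mu> b" unfolding dvd_def by metis
  have AL: "A \<subseteq> L" "a \<in> L" using A a span_base by blast+
  have Lsub: "subspace L" using L by (auto dest: direct_factor_subspace)
  let ?v = "\<lambda>b. b - \<mu> b *s a"
  let ?A = "?v ` (A - {a})"
  have fin: "finite (insert a ?A)" using A by auto
  have "b \<in> span (insert a ?A)" if "b \<in> A" for b
  proof (cases "b = a")
    case False
    then have "?v b + \<mu> b *s a \<in> span (insert a ?A)"
      using that by (intro span_add span_scale span_base) auto
    then show ?thesis by simp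
  qed (auto intro: span_base)
  moreover have "insert a ?A \<subseteq> span A"
    using a by (auto intro!: span_diff span_scale intro: span_base)
  ultimately have "span (insert a ?A) = span A"
    by (simp add: span_eq subset_iff)
  then have sp: "span (insert a ?A) = L" using A by simp
  have cA: "card ?A \<le> m - Suc (card K)"
    using card_image_le[of "A - {a}" ?v] A a by auto
  have "Suc (card ?A) \<le> m - card K" using cA insert by auto
  then have le: "card (insert a ?A) \<le> m - card K" using fin by (auto simp: card_insert_if)
  have bas: "is_basis scale L (insert a ?A)" "card (insert a ?A) = m - card K"
    using spanning_card_le_basis[OF L(2) fin sp le] by auto
  have an: "a \<notin> ?A" 
  proof
    assume "a \<in> ?A"
    then have "insert a ?A = ?A" by auto
    then have "card ?A = m - card K" using bas by simp
    then show False using cA insert by auto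
  qed
  have cA': "card ?A = m - card (insert k K)" using an bas fin insert by auto
  have ind: "independent (?A \<union> {a})" "span (?A \<union> {a}) = L" using bas by (auto simp: is_basis_def)
  have df: "direct_factor scale (span ?A) M"
    using direct_factor_span[OF ind(1)] an L(1) ind(2) direct_factor_trans by auto
  have indA: "independent ?A" using ind independent_mono by blast
  have sAL: "span ?A \<subseteq> L" using ind span_mono by blast
  have "g k x = 0" if "x \<in> span ?A" for x
  proof -
    have 0: "g k 0 = 0" using insert.prems(3)[of k "0" 0] subspace_0 Lsub LM by force
    have sub: "subspace {x\<in>L. g k x = 0}"
      using Lsub LM 0 insert.prems(2,3) unfolding subspace_def by (auto simp: subset_iff)
    have "?A \<subseteq> {x\<in>L. g k x = 0}"
    proof
      fix y assume "y \<in> ?A"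
      then obtain b where b: "b \<in> A" "y = ?v b" by auto
      have y: "y \<in> L" using b AL Lsub by (auto intro!: subspace_diff subspace_scale)
      have "g k (y + \<mu> b *s a) = g k y + \<mu> b * g k a"
        using y AL Lsub LM insert.prems(2,3) by (auto simp: subset_iff subspace_scale)
      then have "g k y = 0" using b \<mu> by (simp add: mult.commute)
      then show "y \<in> {x\<in>L. g k x = 0}" using y by auto
    qed
    then show ?thesis using span_minimal[OF _ sub] that by blast
  qed
  then have "\<forall>k'\<in>insert k K. \<forall>x\<in>span ?A. g k' x = 0"
    using L(3) sAL by auto
  then show ?case
    using df cA' free_of_rank_span[OF indA] A(1) by (intro exI[of _ "span ?A"]) auto
qed

text \<open>In a basis \<open>B \<union> C\<close> of \<open>P\<close> adapted to \<open>N\<close>,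
  membership in \<open>N\<close> is the vanishing of the \<open>c - b\<close> coordinates along
  \<open>C\<close>; these are the linear forms to be killed on \<open>M\<close>.\<close>

lemma direct_factor_in_Int:
  assumes P: "free_of_rank scale P c" and M: "direct_factor scale M P" "free_of_rank scale M a"
    and N: "direct_factor scale N P" "free_of_rank scale N b" and le: "c \<le> a + b"
  shows "\<exists>L. direct_factor scale L P \<and> free_of_rank scale L (a + b - c) \<and> L \<subseteq> M \<inter> N"
proof -
  obtain B C where BC: "finite B" "finite C" "B \<inter> C = {}" "is_basis scale N B"
    "is_basis scale P (B \<union> C)" "card B + card C = c"
    using direct_factor_bases[OF N(1) P] .
  have cB: "card B = b" using basis_finite_card[OF N(2) BC(4)] by simp
  have MP: "M \<subseteq> P" using M direct_factor_subset by blast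
  have ind: "independent (B \<union> C)" "span (B \<union> C) = P" using BC by (auto simp: is_basis_def)
  have "card C \<le> a" using le BC cB by auto
  then obtain L where L: "direct_factor scale L M" "free_of_rank scale L (a - card C)"
     "\<forall>k\<in>C. \<forall>x\<in>L. representation (B \<union> C) x k = 0"
    using kernel_contains_direct_factor[OF BC(2) _ M(2), of "\<lambda>k x. representation (B \<union> C) x k"]
      ind MP representation_add[OF ind(1)] representation_scale[OF ind(1)] by (auto simp: subset_iff)
  have LM: "L \<subseteq> M" using L direct_factor_subset by blast
  have "x \<in> N" if "x \<in> L" for x
  proof -
    let ?R = "representation (B \<union> C) x"
    have "x = (\<Sum>v\<in>B \<union> C. ?R v *s v)"
      using that LM MP ind BC by (intro sum_representation_eq[symmetric]) auto
    moreover have "\<dots> = (\<Sum>v\<in>B. ?R v *s v)"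
      using that L BC by (intro sum.mono_neutral_right) auto
    moreover have "\<dots> \<in> span B" by (intro span_sum span_scale span_base)
    ultimately show ?thesis using BC by (simp add: is_basis_def)
  qed
  moreover have "a - card C = a + b - c" using BC cB by auto
  ultimately show ?thesis
    using L LM direct_factor_trans[OF L(1) M(1)] by (intro exI[of _ L]) auto
qed

text \<open>Modulo \<open>M\<close>, the vector \<open>x\<close> is a multiple of a vector
  \<open>y\<close> having coefficient 1 at a basis vector \<open>q\<close>. Exchanging
  \<open>q\<close> for \<open>y\<close> keeps a basis of \<open>P\<close> and puts \<open>y\<close>
  next to a basis of \<open>M\<close>.\<close>

lemma direct_factor_add_vector:
  assumes P: "free_of_rank scale P c" and M: "direct_factor scale M P" "free_of_rank scale M a"
    and "a < c" and x: "x \<in> P"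
  shows "\<exists>L. direct_factor scale L P \<and> free_of_rank scale L (Suc a) \<and> M \<subseteq> L \<and> x \<in> L"
proof -
  obtain A Q where AQ: "finite A" "finite Q" "A \<inter> Q = {}" "is_basis scale M A"
    "is_basis scale P (A \<union> Q)" "card A + card Q = c"
    using direct_factor_bases[OF M(1) P] .
  have cA: "card A = a" using basis_finite_card[OF M(2) AQ(4)] by simp
  have ind: "independent (A \<union> Q)" "span (A \<union> Q) = P" using AQ by (auto simp: is_basis_def)
  let ?R = "representation (A \<union> Q) x"
  have "Q \<noteq> {}" using AQ cA assms by auto
  then obtain q where q: "q \<in> Q" "\<forall>b\<in>Q. ?R q dvd ?R b"
    using finite_chain_has_divisor[OF AQ(2)] chain by blast
  then obtain \<mu> where \<mu>: "\<And>b. b \<in> Q \<Longrightarrow> ?R b = ?R q * \<mu> b" unfolding dvd_def by metis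
  \<comment> \<open>The part of \<open>x\<close> along \<open>Q\<close>, formally divided by its
    coordinate at \<open>q\<close>, which divides the others.\<close>
  define y where "y = q + (\<Sum>b\<in>Q - {q}. \<mu> b *s b)"
  have yP: "y \<in> P"
    unfolding y_def ind(2)[symmetric] using q
    by (intro span_add span_sum span_scale span_base) auto
  have "x = (\<Sum>v\<in>A \<union> Q. ?R v *s v)"
    using x ind AQ by (intro sum_representation_eq[symmetric]) auto
  also have "\<dots> = (\<Sum>v\<in>A. ?R v *s v) + (\<Sum>v\<in>Q. ?R v *s v)"
    using AQ by (intro sum.union_disjoint) auto
  also have "(\<Sum>v\<in>Q. ?R v *s v) = ?R q *s q + (\<Sum>v\<in>Q - {q}. ?R v *s v)"
    using AQ q by (simp add: sum.remove)
  also have "(\<Sum>v\<in>Q - {q}. ?R v *s v) = ?R q *s (\<Sum>b\<in>Q - {q}. \<mu> b *s b)"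
    unfolding scale_sum_right by (intro sum.cong) (simp_all add: \<mu>)
  finally have xy: "x = (\<Sum>v\<in>A. ?R v *s v) + ?R q *s y"
    by (simp add: y_def scale_right_distrib)
  let ?S = "insert y A \<union> (Q - {q})"
  have "q \<in> span ?S"
  proof -
    have "y - (\<Sum>b\<in>Q - {q}. \<mu> b *s b) \<in> span ?S"
      by (intro span_diff span_sum span_scale span_base) auto
    then show ?thesis by (simp add: y_def)
  qed
  then have "A \<union> Q \<subseteq> span ?S" by (auto intro: span_base)
  moreover have "?S \<subseteq> span (A \<union> Q)" using yP ind by (auto intro: span_base)
  ultimately have sp: "span ?S = P"
    using ind(2) by (metis span_eq)
  have "card ?S \<le> card (insert y A) + card (Q - {q})" by (rule card_Un_le)
  also have "\<dots> \<le> Suc (card A) + (card Q - 1)"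
    using AQ q by (intro add_mono) (auto simp: card_insert_if)
  also have "\<dots> = c" using AQ \<open>Q \<noteq> {}\<close> by (metis Suc_pred' add_Suc_shift card_gt_0_iff plus_1_eq_Suc add.commute add_Suc)
  finally have le: "card ?S \<le> c" .
  have bas: "is_basis scale P ?S" "card ?S = c"
    using spanning_card_le_basis[OF P _ sp le] AQ by auto
  have cq: "Suc (card (Q - {q})) = card Q" using AQ q by (metis card.remove finite_Diff card_Suc_Diff1)
  \<comment> \<open>As \<open>?S\<close> attains the size \<open>c\<close>, its pieces
    \<open>{y}\<close>, \<open>A\<close> and \<open>Q - {q}\<close> cannot overlap.\<close>
  have cins: "card (insert y A) = Suc a"
    using \<open>card ?S \<le> card (insert y A) + card (Q - {q})\<close> bas cq AQ cA card_insert_le_m1[of "Suc a" A y]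
    by (simp add: card_insert_if split: if_splits)
  have "card (insert y A) + card (Q - {q}) = c"
    using cq cins AQ cA by simp
  then have "card (insert y A \<inter> (Q - {q})) = 0"
    using card_Un_Int[of "insert y A" "Q - {q}"] bas AQ by simp
  then have disj: "insert y A \<inter> (Q - {q}) = {}" using AQ by simp
  have iS: "independent ?S" using bas by (simp add: is_basis_def)
  have "direct_factor scale (span (insert y A)) P"
    using direct_factor_span[OF iS disj] sp by simp
  moreover have "free_of_rank scale (span (insert y A)) (Suc a)"
    using free_of_rank_span[of "insert y A"] iS cins AQ independent_mono[OF iS, of "insert y A"] by auto
  moreover have "M \<subseteq> span (insert y A)"
    using AQ span_mono[of A "insert y A"] by (auto simp: is_basis_def)
  moreover have "x \<in> span (insert y A)"
    by (subst xy, intro span_add span_sum span_scale span_base) auto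
  ultimately show ?thesis by (intro exI[of _ "span (insert y A)"]) simp
qed

lemma direct_factor_extend_rank:
  assumes P: "free_of_rank scale P c" and "direct_factor scale M P" "free_of_rank scale M a"
    and "a \<le> n" "n \<le> c"
  shows "\<exists>L. direct_factor scale L P \<and> free_of_rank scale L n \<and> M \<subseteq> L"
  using assms(4,5)
proof (induction n rule: dec_induct)
  case (step n)
  then obtain L where L: "direct_factor scale L P" "free_of_rank scale L n" "M \<subseteq> L" by auto
  \<comment> \<open>Adding the zero vector raises the rank by one without imposing anything.\<close>
  have "0 \<in> P" using P free_of_rank_subspace subspace_0 by blast
  then obtain L' where "direct_factor scale L' P" "free_of_rank scale L' (Suc n)" "L \<subseteq> L'"
    using direct_factor_add_vector[OF P L(1,2), of 0] step by auto
  then show ?case using L(3) by blast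
qed (use assms in auto)

lemma direct_factor_add_vectors:
  assumes P: "free_of_rank scale P c" and "direct_factor scale M P" "free_of_rank scale M a"
    and "finite B" "B \<subseteq> P" "a + card B \<le> c"
  shows "\<exists>L. direct_factor scale L P \<and> free_of_rank scale L (a + card B) \<and> M \<subseteq> L \<and> B \<subseteq> L"
  using assms(4-6)
proof (induction rule: finite_induct)
  case (insert x B)
  then obtain L where L: "direct_factor scale L P" "free_of_rank scale L (a + card B)" "M \<subseteq> L" "B \<subseteq> L"
    by auto
  moreover have "a + card B < c" "x \<in> P" "a + card (insert x B) = Suc (a + card B)"
    using insert by auto
  ultimately obtain L' where "direct_factor scale L' P" "free_of_rank scale L' (a + card (insert x B))" "L \<subseteq> L'" "x \<in> L'"
    using direct_factor_add_vector[OF P L(1,2), of x] by auto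
  then show ?case using L by blast
qed (use assms in auto)

text \<open>Each generator of \<open>N\<close> is added at the cost of one in rank, even if already
  contained; the remaining ranks are filled up arbitrarily.\<close>

lemma direct_factor_containing_Un:
  assumes P: "free_of_rank scale P c" and M: "direct_factor scale M P" "free_of_rank scale M a"
    and N: "N \<subseteq> P" "free_of_rank scale N b" and le: "a + b \<le> n" "n \<le> c"
  shows "\<exists>L. direct_factor scale L P \<and> free_of_rank scale L n \<and> M \<union> N \<subseteq> L"
proof -
  obtain B where B: "finite B" "card B = b" "span B = N"
    using N by (auto simp: free_of_rank_def is_basis_def)
  have "B \<subseteq> P" using B N span_superset by blast
  then obtain L where L: "direct_factor scale L P" "free_of_rank scale L (a + b)" "M \<subseteq> L" "B \<subseteq> L"
    using direct_factor_add_vectors[OF P M B(1)] B le by auto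
  then obtain L' where L': "direct_factor scale L' P" "free_of_rank scale L' n" "L \<subseteq> L'"
    using direct_factor_extend_rank[OF P L(1,2) le] by blast
  then have "N \<subseteq> L'"
    using span_minimal[of B L'] B L direct_factor_subspace[of L' P] by blast
  then show ?thesis using L L' by blast
qed

end

section \<open>Power sums over a finite subfield\<close>

lemma unit_mult_eq_0:
  fixes u a :: "'r::comm_ring_1"
  assumes "u dvd 1" "u * a = 0"
  shows "a = 0"
proof -
  obtain v where "1 = u * v" using assms(1) by (elim dvdE)
  then have "a = v * (u * a)" by (simp add: mult.assoc[symmetric] mult.commute[of v u])
  then show ?thesis using assms(2) by simp
qed

text \<open>The usual induction works because differences of roots are units and can be cancelled
  although the ring may have zero divisors.\<close>

lemma card_roots_le_degree:
  fixes P :: "'r::comm_ring_1 poly"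
  assumes "finite A" "P \<noteq> 0" "\<And>x. x \<in> A \<Longrightarrow> poly P x = 0"
    and unit: "\<And>x y. x \<in> A \<Longrightarrow> y \<in> A \<Longrightarrow> x \<noteq> y \<Longrightarrow> x - y dvd 1"
  shows "card A \<le> degree P"
  using assms
proof (induction A arbitrary: P rule: finite_induct)
  case (insert x A)
  obtain Q where Q: "P = [:- x, 1:] * Q"
    using insert.prems(2)[of x] by (auto simp: poly_eq_0_iff_dvd)
  then have Q0: "Q \<noteq> 0" using insert.prems by auto
  have "poly Q y = 0" if y: "y \<in> A" for y
  proof -
    have "(y - x) * poly Q y = 0"
      using insert.prems(2)[of y] y by (simp add: Q algebra_simps)
    moreover have "y - x dvd 1"
      using insert.prems(3)[of y x] insert.hyps y by auto
    ultimately show ?thesis by (rule unit_mult_eq_0[rotated])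
  qed
  then have "card A \<le> degree Q"
    using insert.IH[OF Q0] insert.prems(3) by blast
  \<comment> \<open>The linear factor is monic, so no leading coefficient is lost.\<close>
  moreover have "degree P = Suc (degree Q)"
  proof -
    have "P = pCons 0 Q + smult (- x) Q" by (simp add: Q)
    moreover have "degree (smult (- x) Q) < degree (pCons 0 Q)"
      using Q0 degree_smult_le[of "- x" Q] by simp
    ultimately have "degree P = degree (pCons 0 Q)" using degree_add_eq_left by metis
    then show ?thesis using Q0 by simp
  qed
  ultimately show ?case using insert.hyps by simp
qed simp

section \<open>Power sums and traces in a finite field inside a ring\<close>

locale finite_subfield =
  fixes K :: "'r::comm_ring_1 set" and p f :: nat
  assumes prime_p: "prime p" and f_pos: "0 < f" and char_p: "of_nat p = (0::'r)"
    and card_K: "card K = p ^ f"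
    and one_mem: "1 \<in> K"
    and add_mem: "x \<in> K \<Longrightarrow> y \<in> K \<Longrightarrow> x + y \<in> K"
    and mult_mem: "x \<in> K \<Longrightarrow> y \<in> K \<Longrightarrow> x * y \<in> K"
    and inverse_mem: "x \<in> K \<Longrightarrow> x \<noteq> 0 \<Longrightarrow> \<exists>y\<in>K. x * y = 1"
begin

lemma CHAR_eq: "CHAR('r) = p"
proof -
  have "CHAR('r) dvd p" using char_p by (simp add: of_nat_eq_0_iff_char_dvd)
  moreover have "CHAR('r) \<noteq> 1"
    using of_nat_eq_0_iff_char_dvd[of 1, where 'a = 'r] by auto
  ultimately show ?thesis using prime_p by (auto simp: prime_nat_iff)
qed

lemma p_gt_1: "1 < p"
  using prime_p by (rule prime_gt_1_nat)

lemma finite_K: "finite K"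
  using card_K p_gt_1 by (auto intro!: card_ge_0_finite)

lemma zero_mem: "0 \<in> K"
proof -
  have "of_nat n + 1 \<in> K" for n
  proof (induction n)
    case (Suc n)
    then show ?case using add_mem[OF Suc one_mem] by (simp add: add.commute)
  qed (simp add: one_mem)
  from this[of "p - 1"] show ?thesis using char_p p_gt_1 by (simp add: of_nat_diff)
qed

lemma of_nat_mem: "of_nat n \<in> K"
  by (induction n) (auto simp: zero_mem one_mem intro: add_mem)

lemma minus_mem: "x \<in> K \<Longrightarrow> - x \<in> K"
proof -
  assume "x \<in> K"
  moreover have "of_nat (p - 1) = (- 1 :: 'r)"
    using char_p p_gt_1 by (simp add: of_nat_diff)
  ultimately show ?thesis using mult_mem[OF of_nat_mem[of "p - 1"]] by force
qed

lemma power_mem: "x \<in> K \<Longrightarrow> x ^ n \<in> K"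
  by (induction n) (auto simp: one_mem intro: mult_mem)

lemma sum_mem: "(\<And>i. i \<in> A \<Longrightarrow> g i \<in> K) \<Longrightarrow> sum g A \<in> K"
  by (induction A rule: infinite_finite_induct) (auto simp: zero_mem intro: add_mem)

lemma unit_mem: "x \<in> K \<Longrightarrow> x \<noteq> 0 \<Longrightarrow> x dvd 1"
  using inverse_mem by (metis dvdI)

lemma diff_unit: "x \<in> K \<Longrightarrow> y \<in> K \<Longrightarrow> x \<noteq> y \<Longrightarrow> x - y dvd 1"
  using unit_mem[of "x + (- y)"] add_mem[of x "- y"] minus_mem by simp

lemma card_roots_le:
  assumes "A \<subseteq> K" "P \<noteq> 0" "\<And>x. x \<in> A \<Longrightarrow> poly P x = 0"
  shows "card A \<le> degree P"
proof (rule card_roots_le_degree)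
  show "finite A" using assms finite_subset finite_K by blast
  show "x - y dvd 1" if "x \<in> A" "y \<in> A" "x \<noteq> y" for x y
    using that assms(1) by (intro diff_unit) auto
qed fact+

lemma bij_mult: "x \<in> K \<Longrightarrow> x \<noteq> 0 \<Longrightarrow> bij_betw ((*) x) (K - {0}) (K - {0})"
proof -
  assume x: "x \<in> K" "x \<noteq> 0"
  then obtain y where y: "y \<in> K" "x * y = 1" using inverse_mem by blast
  have y0: "y \<noteq> 0" using y by auto
  have *: "u * (v * w) = w" if "u * v = 1" for u v w :: 'r
    using that by (simp flip: mult.assoc)
  have **: "v * w \<noteq> 0" if "u * v = 1" "w \<noteq> 0" for u v w :: 'r
    using *[OF that(1), of w] that(2) by auto
  show ?thesis
    proof (rule bij_betw_byWitness[where f' = "(*) y"])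
    have yx: "y * x = 1" using y by (simp add: mult.commute)
    show "\<forall>a\<in>K - {0}. y * (x * a) = a" "\<forall>a\<in>K - {0}. x * (y * a) = a"
      using *[OF yx] *[OF y(2)] by blast+
    show "(*) x ` (K - {0}) \<subseteq> K - {0}" "(*) y ` (K - {0}) \<subseteq> K - {0}"
      using **[OF yx] **[OF y(2)] x y mult_mem by (auto simp del: mult_eq_0_iff)
  qed
qed

text \<open>As for Fermat's little theorem: multiplication by \<open>x\<close> permutes the nonzero
  elements, whose product is a unit and cancels.\<close>

lemma power_card_minus_1:
  assumes "x \<in> K" "x \<noteq> 0"
  shows "x ^ (p ^ f - 1) = 1"
proof -
  let ?P = "\<Prod>c\<in>K - {0}. c"
  have card: "card (K - {0}) = p ^ f - 1"
    using zero_mem finite_K card_K by simp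
  have "?P dvd 1"
  proof -
    have "(\<Prod>c\<in>A. c) dvd 1" if "A \<subseteq> K - {0}" for A
      using finite_subset[OF that finite_Diff[OF finite_K]] that
    proof (induction A rule: finite_induct)
      case (insert a A)
      then show ?case using unit_mem[of a] mult_dvd_mono[of a 1 "\<Prod>A" 1] by simp
    qed simp
    then show ?thesis by blast
  qed
  then obtain u where u: "1 = ?P * u" by (elim dvdE)
  have "?P = (\<Prod>c\<in>K - {0}. x * c)"
    using prod.reindex_bij_betw[OF bij_mult[OF assms], of "\<lambda>c. c"] by simp
  also have "\<dots> = x ^ (p ^ f - 1) * ?P"
    by (simp add: prod.distrib card)
  finally have "?P * u = x ^ (p ^ f - 1) * ?P * u" by (rule arg_cong)
  then have "?P * u = x ^ (p ^ f - 1) * (?P * u)" by (simp only: mult.assoc)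
  then show ?thesis by (simp flip: u)
qed

lemma power_card: "x \<in> K \<Longrightarrow> x ^ (p ^ f) = x"
  using power_card_minus_1[of x] p_gt_1 power_Suc[of x "p ^ f - 1"]
  by (cases "x = 0") (simp_all add: power_0_left)

lemma exists_power_ne_1:
  assumes "0 < m" "m < p ^ f - 1"
  shows "\<exists>b\<in>K - {0}. b ^ m \<noteq> 1"
proof (rule ccontr)
  assume "\<not> ?thesis"
  then have r: "poly (monom 1 m - 1) b = 0" if "b \<in> K - {0}" for b
    using that by (auto simp: poly_monom)
  have lt: "degree (- 1 :: 'r poly) < degree (monom (1::'r) m)"
    using assms by (simp add: degree_monom_eq)
  have deg: "degree (monom 1 m - 1 :: 'r poly) = m"
    using degree_add_eq_left[OF lt] by (simp add: degree_monom_eq)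
  then have "monom 1 m - 1 \<noteq> (0 :: 'r poly)" using assms by auto
  then have "card (K - {0}) \<le> m"
    using card_roots_le[of "K - {0}", OF _ _ r] deg by auto
  then show False using assms zero_mem finite_K card_K by simp
qed

text \<open>Orthogonality of characters: replacing \<open>c\<close> by \<open>b * c\<close>
  multiplies the sum by \<open>b ^ m\<close>, and \<open>b ^ m - 1\<close> is a unit for a suitable
  \<open>b\<close>. For the trivial character all \<open>p ^ f - 1\<close> terms are 1, and
  \<open>p\<close> vanishes in the ring.\<close>

lemma power_sum:
  "(\<Sum>c\<in>K - {0}. c ^ m) = (if (p ^ f - 1) dvd m then - 1 else 0)"
proof (cases "(p ^ f - 1) dvd m")
  case True
  have "c ^ m = 1" if "c \<in> K - {0}" for c
    using True that power_card_minus_1[of c] by (auto simp: power_mult elim!: dvdE)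
  then have "(\<Sum>c\<in>K - {0}. c ^ m) = of_nat (p ^ f - 1)"
    using zero_mem finite_K card_K by simp
  also have "\<dots> = - 1"
    using p_gt_1 f_pos char_p by (simp add: of_nat_diff power_0_left)
  finally show ?thesis using True by simp
next
  case False
  let ?q = "p ^ f - 1" and ?S = "\<Sum>c\<in>K - {0}. c ^ m"
  have "0 < ?q" using p_gt_1 f_pos one_less_power[of p f] by simp
  then have "0 < m mod ?q" "m mod ?q < ?q" using False by (auto simp: mod_greater_zero_iff_not_dvd)
  then obtain b where b: "b \<in> K - {0}" "b ^ (m mod ?q) \<noteq> 1"
    using exists_power_ne_1 by blast
  have "b ^ m = b ^ (?q * (m div ?q) + m mod ?q)" by simp
  also have "\<dots> = b ^ (m mod ?q)"
    using power_card_minus_1[of b] b(1) by (simp only: power_add power_mult) simp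
  finally have bm: "b ^ m \<noteq> 1" using b by simp
  have "?S = (\<Sum>c\<in>K - {0}. (b * c) ^ m)"
    using b sum.reindex_bij_betw[OF bij_mult[of b], of "\<lambda>c. c ^ m"] by simp
  also have "\<dots> = b ^ m * ?S" by (simp add: power_mult_distrib sum_distrib_left)
  finally have "(b ^ m - 1) * ?S = 0" by (simp add: algebra_simps)
  moreover have "b ^ m - 1 dvd 1"
    using diff_unit[OF power_mem one_mem bm] b by auto
  ultimately have "?S = 0" by (rule unit_mult_eq_0[rotated])
  then show ?thesis using False by simp
qed

text \<open>The \<open>p\<close> multiples of 1 already exhaust the roots of
  \<open>X ^ p - X\<close>.\<close>

lemma frobenius_fixed:
  assumes "x \<in> K" "x ^ p = x"
  shows "\<exists>n. x = of_nat n"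
proof (rule ccontr)
  assume x: "\<nexists>n. x = of_nat n"
  let ?A = "insert x (of_nat ` {..<p})" and ?P = "monom 1 p - [:0, 1:] :: 'r poly"
  have lt: "degree (- [:0, 1:] :: 'r poly) < degree (monom (1::'r) p)"
    using p_gt_1 by (simp add: degree_monom_eq)
  have deg: "degree ?P = p"
    unfolding diff_conv_add_uminus degree_add_eq_left[OF lt] by (simp add: degree_monom_eq)
  have "of_nat n ^ p = (of_nat n :: 'r)" for n
  proof -
    have "(\<Sum>i<n. 1::'r) ^ p = (\<Sum>i<n. 1 ^ p)"
      using CHAR_eq prime_p by (intro freshmans_dream_sum) auto
    then show ?thesis unfolding power_one sum_constant by simp
  qed
  then have "poly ?P a = 0" if "a \<in> ?A" for a
    using that assms by (auto simp: poly_monom)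
  moreover have "?P \<noteq> 0" using deg p_gt_1 by auto
  ultimately have "card ?A \<le> p"
    using card_roots_le[of ?A ?P] assms of_nat_mem deg by auto
  moreover have "inj_on (of_nat :: nat \<Rightarrow> 'r) {..<p}"
  proof (rule linorder_inj_onI)
    fix m n assume "m < n" "m \<in> {..<p}" "n \<in> {..<p}"
    then have "\<not> p dvd n - m" by (auto dest: dvd_imp_le)
    then have "of_nat (n - m) \<noteq> (0::'r)" using CHAR_eq by (simp add: of_nat_eq_0_iff_char_dvd)
    then show "of_nat m \<noteq> (of_nat n :: 'r)" using \<open>m < n\<close> by (simp add: of_nat_diff)
  qed auto
  moreover have "x \<notin> of_nat ` {..<p}" using x by auto
  ultimately show False by (simp add: card_image)
qed

lemma power_less_card: "i < f \<Longrightarrow> p ^ i \<le> p ^ f - 1"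
  using p_gt_1 power_strict_increasing[of i f p] by linarith

text \<open>Exponents of nonzero elements count modulo \<open>p ^ f - 1\<close>, so
  \<open>p ^ f - 1 - p ^ i\<close> is a natural number standing for
  \<open>- (p ^ i)\<close>.\<close>

lemma power_complement:
  assumes "c \<in> K" "c \<noteq> 0" "i < f"
  shows "c ^ (p ^ f - 1 - p ^ i + p ^ i) = 1"
  using power_less_card[OF assms(3)] power_card_minus_1[OF assms(1,2)]
  by (simp only: le_add_diff_inverse2)

text \<open>The sum is the trace of the inverse \<open>d\<close> of \<open>c\<close>. The
  \<open>p\<close>-th power map permutes the conjugates of \<open>d\<close> cyclically, so it fixes
  the trace, which therefore lies in the prime field.\<close>

lemma trace_dual:
  assumes "c \<in> K" "c \<noteq> 0"
  shows "\<exists>n. (\<Sum>i<f. c ^ (p ^ f - 1 - p ^ i)) = of_nat n"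
proof -
  obtain d where d: "d \<in> K" "c * d = 1" using inverse_mem assms by blast
  have "c ^ (p ^ f - 1 - p ^ i) = d ^ (p ^ i)" if "i < f" for i
  proof -
    have "c ^ (p ^ f - 1 - p ^ i) * c ^ (p ^ i) = 1"
      using power_complement[OF assms that] by (simp only: power_add)
    moreover have "c ^ (p ^ i) * d ^ (p ^ i) = 1"
      using d by (simp flip: power_mult_distrib)
    ultimately show ?thesis
      by (metis (no_types) mult.assoc mult.commute mult_1)
  qed
  then have s: "(\<Sum>i<f. c ^ (p ^ f - 1 - p ^ i)) = (\<Sum>i<f. d ^ (p ^ i))" by simp
  have "(\<Sum>i<f. d ^ (p ^ i)) ^ p = (\<Sum>i<f. (d ^ (p ^ i)) ^ p)"
    using CHAR_eq prime_p by (intro freshmans_dream_sum) auto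
  also have "\<dots> = (\<Sum>i<f. d ^ (p ^ Suc i))"
    by (simp add: power_mult[symmetric] mult.commute)
  \<comment> \<open>Shifting the index loses \<open>d\<close> and gains \<open>d ^ (p ^ f)\<close>,
    which is \<open>d\<close> again.\<close>
  also have "\<dots> = (\<Sum>i<Suc f. d ^ (p ^ i)) - d"
    by (subst sum.lessThan_Suc_shift) simp
  also have "\<dots> = (\<Sum>i<f. d ^ (p ^ i))"
    using power_card[OF d(1)] by simp
  finally have "(\<Sum>i<f. d ^ (p ^ i)) ^ p = (\<Sum>i<f. d ^ (p ^ i))" .
  then show ?thesis
    unfolding s using d power_mem by (intro frobenius_fixed sum_mem) auto
qed

text \<open>The exponent lies strictly between 0 and twice \<open>p ^ f - 1\<close>, so divisibility
  forces it to equal \<open>p ^ f - 1\<close>.\<close>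

lemma dvd_exponent_iff:
  assumes "i < f" "j < f"
  shows "(p ^ f - 1) dvd (p ^ f - 1 - p ^ i + p ^ j) \<longleftrightarrow> i = j"
proof
  assume dvd: "(p ^ f - 1) dvd (p ^ f - 1 - p ^ i + p ^ j)"
  let ?N = "p ^ f - 1 - p ^ i + p ^ j"
  have pos: "1 \<le> p ^ i" "1 \<le> p ^ j" using p_gt_1 by auto
  have le: "p ^ i \<le> p ^ f - 1" "p ^ j \<le> p ^ f - 1" using power_less_card assms by auto
  obtain k where k: "?N = (p ^ f - 1) * k" using dvd by (elim dvdE)
  have "k = 1"
  proof (rule ccontr)
    assume "k \<noteq> 1"
    then have "k = 0 \<or> 2 \<le> k" by auto
    then have "?N = 0 \<or> (p ^ f - 1) * 2 \<le> ?N"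
      unfolding k by (auto intro: mult_le_mono2)
    then show False using pos le by linarith
  qed
  then have "p ^ i = p ^ j" using k le by simp
  then show "i = j" using p_gt_1 power_inject_exp by blast
next
  assume "i = j"
  then show "(p ^ f - 1) dvd (p ^ f - 1 - p ^ i + p ^ j)"
    using power_less_card[OF assms(1)] by (simp only: le_add_diff_inverse2 dvd_refl)
qed

lemma dvd_exponent_Suc_iff:
  assumes "i < f"
  shows "(p ^ f - 1) dvd (p ^ f - 1 - p ^ i + 1) \<longleftrightarrow> i = 0"
  using dvd_exponent_iff[OF assms f_pos] by simp

end

section \<open>The grading of the Dieudonne module\<close>

locale graded_dieudonne =
  dieudonne_evaluation_action sE sT F V p f h \<tau> \<omega> act \<phi> + finite_subfield "range \<phi>" p f
  for sE :: "'r::comm_ring_1 \<Rightarrow> 'e::ab_group_add \<Rightarrow> 'e"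
    and sT :: "'r \<Rightarrow> 't::ab_group_add \<Rightarrow> 't"
    and F :: "'t \<Rightarrow> 'e" and V :: "'e \<Rightarrow> 't"
    and p f h :: nat and \<tau> :: "'e \<Rightarrow> 't" and \<omega> :: "'e set"
    and act :: "'o::comm_ring_1 \<Rightarrow> 'e \<Rightarrow> 'e" and \<phi> :: "'o \<Rightarrow> 'r" +
  assumes ring_chain: "x dvd y \<or> y dvd (x::'r)"
    and \<phi>_one: "\<phi> 1 = 1" and \<phi>_add: "\<phi> (a + b) = \<phi> a + \<phi> b" and \<phi>_mult: "\<phi> (a * b) = \<phi> a * \<phi> b"
    and \<phi>_kernel: "\<phi> a = 0 \<Longrightarrow> of_nat p dvd a"
begin

sublocale CE: chain_module sE
  by unfold_locales (rule ring_chain)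

sublocale CT: chain_module sT
  by unfold_locales (rule ring_chain)

sublocale \<phi>: additive \<phi>
  by unfold_locales (rule \<phi>_add)

sublocale \<tau>: additive \<tau>
  using T_twist by unfold_locales (simp add: frobenius_twist_def)

lemma \<tau>_scale: "\<tau> (sE c x) = sT (c ^ p) (\<tau> x)"
  using T_twist by (simp add: frobenius_twist_def)

lemma \<phi>_of_nat: "\<phi> (of_nat n) = of_nat n"
  by (induction n) (simp_all add: \<phi>.zero \<phi>_add \<phi>_one)

lemma act_of_nat: "act (of_nat n) x = sE (of_nat n) x"
  by (induction n) (simp_all add: A.scale_left_distrib E.scale_left_distrib)

text \<open>The ring has characteristic \<open>p\<close>, so multiples of \<open>p\<close> act as
  zero and the action factors through the residue field.\<close>

lemma act_cong:
  assumes "\<phi> a = \<phi> b"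
  shows "act a x = act b x"
proof -
  have "\<phi> (a - b) = 0" using assms by (simp add: \<phi>.diff)
  then obtain c where "a - b = of_nat p * c" using \<phi>_kernel by (auto elim: dvdE)
  then have "act (a - b) x = act (of_nat p) (act c x)" by simp
  also have "\<dots> = 0" unfolding act_of_nat char_p by simp
  finally show ?thesis by (simp add: A.scale_left_diff_distrib)
qed

text \<open>A section of \<open>\<phi>\<close> as a map of sets; by \<open>act_cong\<close> the
  action does not depend on the choice of lifts.\<close>

definition lift :: "'r \<Rightarrow> 'o" where
  "lift c = inv \<phi> c"

lemma \<phi>_lift: "c \<in> range \<phi> \<Longrightarrow> \<phi> (lift c) = c"
  by (simp add: lift_def f_inv_into_f)

text \<open>The projector onto the isotypic part of the character \<open>c ^ (p ^ i)\<close> of the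
  nonzero residue classes. Their number \<open>p ^ f - 1\<close> is \<open>- 1\<close> in the ring,
  so dividing by the group order is a change of sign; the exponent is that of the inverse
  character.\<close>

definition proj :: "nat \<Rightarrow> 'e \<Rightarrow> 'e" where
  "proj i x = - (\<Sum>c\<in>range \<phi> - {0}. sE (c ^ (p ^ f - 1 - p ^ i)) (act (lift c) x))"

lemma proj_add: "proj i (x + y) = proj i x + proj i y"
  by (simp add: proj_def A.scale_right_distrib E.scale_right_distrib sum.distrib)

lemma proj_scale: "proj i (sE c x) = sE c (proj i x)"
  by (simp add: proj_def act_linear E.scale_sum_right mult.commute)

sublocale proj: module_hom sE sE "proj i" for i
  by unfold_locales (simp_all add: proj_add proj_scale)

lemma act_hom: "module_hom sE sE (act a)"
  by unfold_locales (simp_all add: A.scale_right_distrib act_linear)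

lemma part_subspace: "E.subspace (part i)"
  by (auto simp: E.subspace_def part_def A.scale_right_distrib E.scale_right_distrib act_linear
      mult.commute)

text \<open>Acting by \<open>b\<close> with nonzero residue reindexes the sum by
  \<open>\<phi> b * c\<close>, which factors out \<open>\<phi> b ^ (p ^ i)\<close>; elements of zero
  residue act as zero.\<close>

lemma proj_in_part:
  assumes "i < f"
  shows "proj i x \<in> part i"
proof -
  let ?m = "p ^ f - 1 - p ^ i" and ?K = "range \<phi> - {0}"
  have "act b (proj i x) = sE (\<phi> b ^ (p ^ i)) (proj i x)" for b
  proof (cases "\<phi> b = 0")
    case True
    then have "act b y = act 0 y" for y by (intro act_cong) (simp add: \<phi>.zero)
    then show ?thesis using True p_gt_1 by (simp add: power_0_left)
  next
    case False
    have "act b (proj i x) = - (\<Sum>c\<in>?K. sE (c ^ ?m) (act (lift (\<phi> b * c)) x))"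
    proof -
      have "act (b * lift c) x = act (lift (\<phi> b * c)) x" if "c \<in> ?K" for c
        using that mult_mem[of "\<phi> b" c] by (intro act_cong) (auto simp: \<phi>_mult \<phi>_lift)
      then show ?thesis
        unfolding proj_def A.scale_minus_right A.scale_sum_right by (simp add: act_linear)
    qed
    also have "\<dots> = - (\<Sum>c\<in>?K. sE (\<phi> b ^ (p ^ i)) (sE ((\<phi> b * c) ^ ?m) (act (lift (\<phi> b * c)) x)))"
    proof -
      have one: "\<phi> b ^ (p ^ i) * \<phi> b ^ ?m = 1"
        using power_complement[OF _ False assms] by (simp only: power_add mult.commute rangeI)
      have "\<phi> b ^ (p ^ i) * (\<phi> b * c) ^ ?m = c ^ ?m" for c
        unfolding power_mult_distrib mult.assoc[symmetric] one by simp
      then show ?thesis by simp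
    qed
    also have "\<dots> = sE (\<phi> b ^ (p ^ i)) (- (\<Sum>c\<in>?K. sE ((\<phi> b * c) ^ ?m) (act (lift (\<phi> b * c)) x)))"
      by (simp only: E.scale_sum_right E.scale_minus_right)
    also have "(\<Sum>c\<in>?K. sE ((\<phi> b * c) ^ ?m) (act (lift (\<phi> b * c)) x))
        = (\<Sum>c\<in>?K. sE (c ^ ?m) (act (lift c) x))"
      using False by (intro sum.reindex_bij_betw[OF bij_mult]) auto
    finally show ?thesis by (simp only: proj_def)
  qed
  then show ?thesis by (simp add: part_def)
qed

text \<open>On \<open>part j\<close> the operator is multiplication by minus a power sum, and
  orthogonality evaluates it.\<close>

lemma proj_on_part:
  assumes "i < f" "j < f" "x \<in> part j"
  shows "proj i x = (if i = j then x else 0)"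
proof -
  have "proj i x = - (\<Sum>c\<in>range \<phi> - {0}. sE (c ^ (p ^ f - 1 - p ^ i + p ^ j)) x)"
    using assms(3) by (auto simp: proj_def part_def \<phi>_lift power_add intro!: sum.cong)
  also have "\<dots> = sE (- (\<Sum>c\<in>range \<phi> - {0}. c ^ (p ^ f - 1 - p ^ i + p ^ j))) x"
    by (simp only: E.scale_sum_left E.scale_minus_left)
  finally show ?thesis
    unfolding power_sum dvd_exponent_iff[OF assms(1,2)] by simp
qed

text \<open>In the sum of all projections, \<open>act (lift c)\<close> has coefficient minus a
  trace, hence an integer. The sum is therefore the action of a single element of \<open>'o\<close>,
  and the power sums show that its residue is 1.\<close>

lemma sum_proj: "(\<Sum>i<f. proj i x) = x"
proof -
  let ?K = "range \<phi> - {0}" and ?m = "\<lambda>i. p ^ f - 1 - p ^ i"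
  have "\<exists>n. \<forall>c\<in>?K. (\<Sum>i<f. c ^ ?m i) = of_nat (n c)"
    using trace_dual by (intro bchoice) auto
  then obtain n where n: "\<And>c. c \<in> ?K \<Longrightarrow> (\<Sum>i<f. c ^ ?m i) = of_nat (n c)" by blast
  let ?a = "\<Sum>c\<in>?K. of_nat (n c) * lift c"
  have "(\<Sum>i<f. proj i x) = - (\<Sum>i<f. \<Sum>c\<in>?K. sE (c ^ ?m i) (act (lift c) x))"
    by (simp add: proj_def sum_negf)
  also have "(\<Sum>i<f. \<Sum>c\<in>?K. sE (c ^ ?m i) (act (lift c) x))
      = (\<Sum>c\<in>?K. sE (\<Sum>i<f. c ^ ?m i) (act (lift c) x))"
    unfolding E.scale_sum_left by (rule sum.swap)
  also have "\<dots> = (\<Sum>c\<in>?K. act (of_nat (n c) * lift c) x)"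
    using n by (intro sum.cong) (simp_all add: act_of_nat flip: A.scale_scale)
  also have "\<dots> = act ?a x" by (simp only: A.scale_sum_left)
  finally have "(\<Sum>i<f. proj i x) = act (- ?a) x" by simp
  also have "\<dots> = act 1 x"
  proof (rule act_cong)
    have "\<phi> ?a = (\<Sum>c\<in>?K. (\<Sum>i<f. c ^ ?m i) * c)"
      using n by (simp add: \<phi>.sum \<phi>_mult \<phi>_of_nat \<phi>_lift)
    also have "\<dots> = (\<Sum>i<f. \<Sum>c\<in>?K. c ^ (?m i + 1))"
      unfolding sum_distrib_right by (subst sum.swap) (simp add: mult.commute)
    also have "\<dots> = (\<Sum>i<f. if i = 0 then - 1 else 0)"
      unfolding power_sum using dvd_exponent_Suc_iff by (intro sum.cong) auto
    also have "\<dots> = - 1" using f_pos by simp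
    finally show "\<phi> (- ?a) = \<phi> 1" by (simp add: \<phi>.minus \<phi>_one)
  qed
  finally show ?thesis by simp
qed

lemma \<omega>_subspace: "E.subspace \<omega>"
  using hodge_direct_factor by (rule E.direct_factor_subspace)

lemma proj_\<omega>: "x \<in> \<omega> \<Longrightarrow> proj i x \<in> \<omega>"
  unfolding proj_def
  by (intro E.subspace_neg E.subspace_sum E.subspace_scale \<omega>_subspace act_hodge)

lemma hodge_subspace: "E.subspace (hodge i)"
  unfolding hodge_def by (intro E.subspace_inter \<omega>_subspace part_subspace)

lemma hodge_subset_part: "hodge i \<subseteq> part i"
  by (simp add: hodge_def)

text \<open>A projection onto \<open>\<omega>\<close> need not respect the action; following it by
  \<open>proj i\<close>, which preserves \<open>\<omega>\<close>, gives a retraction of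
  \<open>part i\<close> onto \<open>hodge i\<close>.\<close>

lemma hodge_direct_factor_part:
  assumes "i < f"
  shows "direct_factor sE (hodge i) (part i)"
proof -
  obtain \<pi> where \<pi>: "\<forall>x y. \<pi> (x + y) = \<pi> x + \<pi> y" "\<forall>c x. \<pi> (sE c x) = sE c (\<pi> x)"
    "\<forall>x. \<pi> x \<in> \<omega>" "\<forall>x\<in>\<omega>. \<pi> x = x"
    using E.direct_factor_projection[OF hodge_direct_factor] by auto
  show ?thesis
    by (rule E.direct_factor_retraction[where \<rho> = "\<lambda>x. proj i (\<pi> x)"])
      (use \<pi> assms proj_\<omega> proj_in_part proj_on_part in
        \<open>auto simp: hodge_def proj_add proj_scale intro!: E.subspace_inter \<omega>_subspace part_subspace\<close>)
qed

section \<open>Frobenius twists, and \<open>F\<close> and \<open>V\<close> on the parts\<close>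

abbreviation twist :: "'e set \<Rightarrow> 't set" where
  "twist M \<equiv> T.span (\<tau> ` M)"

lemma \<tau>_span: "x \<in> E.span A \<Longrightarrow> \<tau> x \<in> twist A"
  by (induction rule: E.span_induct_alt)
    (auto simp: \<tau>.zero \<tau>.add \<tau>_scale T.span_zero intro!: T.span_add T.span_scale intro: T.span_base)

lemma twist_span: "twist (E.span A) = twist A"
proof
  show "twist (E.span A) \<subseteq> twist A"
    using \<tau>_span by (intro T.span_minimal) auto
qed (intro T.span_mono image_mono E.span_superset)

lemma twist_UNIV: "twist UNIV = UNIV"
proof -
  obtain B where "is_basis sT UNIV (\<tau> ` B)" using T_twist by (auto simp: frobenius_twist_def)
  then have "T.span (\<tau> ` B) = UNIV" by (simp add: is_basis_def)
  then show ?thesis using T.span_mono[of "\<tau> ` B" "range \<tau>"] by auto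
qed

text \<open>The equivariance of \<open>F\<close> and \<open>V\<close> is stated through such a
  \<open>g\<close>. It is defined by its values on the image of a basis under \<open>\<tau>\<close>;
  both sides of the identity are semilinear, so agreement on the basis suffices.\<close>

lemma twist_endomorphism:
  assumes e: "module_hom sE sE e"
  obtains g where "module_hom sT sT g" "\<And>x. g (\<tau> x) = \<tau> (e x)"
proof -
  interpret e: module_hom sE sE e by fact
  obtain B where B: "is_basis sE UNIV B" "inj_on \<tau> B" "is_basis sT UNIV (\<tau> ` B)"
    using T_twist by (auto simp: frobenius_twist_def)
  then have indT: "T.independent (\<tau> ` B)" "T.span (\<tau> ` B) = UNIV" and spE: "E.span B = UNIV"
    by (auto simp: is_basis_def)
  have finB: "finite B" using CE.basis_finite_card[OF E_free B(1)] by simp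
  let ?R = "T.representation (\<tau> ` B)"
  define g where "g y = (\<Sum>b\<in>B. sT (?R y (\<tau> b)) (\<tau> (e b)))" for y
  have hom: "module_hom sT sT g"
  proof
    show "g (x + y) = g x + g y" for x y
      using indT by (simp add: g_def T.representation_add T.scale_left_distrib sum.distrib)
    show "g (sT c x) = sT c (g x)" for c x
      using indT by (simp add: g_def T.representation_scale T.scale_sum_right)
  qed
  then interpret g: module_hom sT sT g .
  have "g (\<tau> x) = \<tau> (e x)" for x
  proof -
    have "x \<in> E.span B" using spE by simp
    then show ?thesis
    proof (induction rule: E.span_induct_alt)
      case (step c b y)
      have "g (\<tau> b) = (\<Sum>b'\<in>B. sT (if b' = b then 1 else 0) (\<tau> (e b')))"
        unfolding g_def using step B(2) indT
        by (intro sum.cong) (auto simp: T.representation_basis inj_on_eq_iff)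
      also have "\<dots> = (\<Sum>b'\<in>B. if b' = b then \<tau> (e b') else 0)"
        by (intro sum.cong) auto
      also have "\<dots> = \<tau> (e b)" using step finB by simp
      finally show ?case
        using step by (simp add: \<tau>.add \<tau>_scale g.add g.scale e.add e.scale)
    qed (simp add: \<tau>.zero)
  qed
  with hom show ?thesis using that by blast
qed

lemma pred_idx_less: "i < f \<Longrightarrow> pred_idx i < f"
  using f_pos by (auto simp: pred_idx_def)

text \<open>The \<open>p\<close>-th power of the inverse character of index \<open>i - 1\<close> is
  that of index \<open>i\<close>; at \<open>i = 0\<close> the cycle closes because
  \<open>c ^ (p ^ f) = c\<close>.\<close>

lemma power_pred_idx:
  assumes "c \<in> range \<phi>" "c \<noteq> 0" "i < f"
  shows "(c ^ (p ^ f - 1 - p ^ pred_idx i)) ^ p = c ^ (p ^ f - 1 - p ^ i)"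
proof -
  have "(c ^ (p ^ f - 1 - p ^ pred_idx i)) ^ p * (c ^ (p ^ pred_idx i)) ^ p = 1"
    unfolding power_mult_distrib[symmetric] power_add[symmetric]
    using power_complement[OF assms(1,2) pred_idx_less[OF assms(3)]] by simp
  moreover have "(c ^ (p ^ pred_idx i)) ^ p = c ^ (p ^ i)"
  proof (cases i)
    case 0
    have "p ^ (f - 1) * p = p ^ f" using f_pos by (simp add: power_eq_if)
    then show ?thesis using 0 power_card[OF assms(1)] by (simp add: pred_idx_def flip: power_mult)
  qed (simp add: pred_idx_def mult.commute flip: power_mult)
  moreover have "c ^ (p ^ f - 1 - p ^ i) * c ^ (p ^ i) = 1"
    using power_complement[OF assms] by (simp only: power_add)
  ultimately show ?thesis
    by (metis (no_types) mult.assoc mult.commute mult_1)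
qed

text \<open>The twist raises scalars to the \<open>p\<close>-th power, so the twist of the projector
  of index \<open>i - 1\<close> is the projector of index \<open>i\<close> for the action on
  \<open>T\<close>. By equivariance \<open>F\<close> and \<open>V\<close> intertwine it with
  \<open>proj i\<close>.\<close>

lemma twisted_projection:
  assumes i: "i < f"
  obtains g where "module_hom sT sT g" "\<And>x. g (\<tau> x) = \<tau> (proj (pred_idx i) x)"
    "\<And>x. V (proj i x) = g (V x)" "\<And>y. F (g y) = proj i (F y)"
proof -
  let ?K = "range \<phi> - {0}" and ?m = "p ^ f - 1 - p ^ i"
  obtain g where g: "module_hom sT sT g" "\<And>x. g (\<tau> x) = \<tau> (proj (pred_idx i) x)"
    using twist_endomorphism[OF proj.module_hom_axioms] by blast
  interpret g: module_hom sT sT g by (rule g)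
  have "\<exists>\<gamma>. \<forall>a. module_hom sT sT (\<gamma> a) \<and> (\<forall>x. \<gamma> a (\<tau> x) = \<tau> (act a x))"
  proof (rule choice, rule allI)
    show "\<exists>g. module_hom sT sT g \<and> (\<forall>x. g (\<tau> x) = \<tau> (act a x))" for a
      using twist_endomorphism[OF act_hom[of a]] by blast
  qed
  then obtain \<gamma> where hom: "\<And>a. module_hom sT sT (\<gamma> a)" and \<gamma>: "\<And>a x. \<gamma> a (\<tau> x) = \<tau> (act a x)"
    by blast
  interpret \<gamma>: module_hom sT sT "\<gamma> a" for a by (rule hom)
  have g_eq: "g y = - (\<Sum>c\<in>?K. sT (c ^ ?m) (\<gamma> (lift c) y))" for y
  proof -
    have "y \<in> twist UNIV" using twist_UNIV by simp
    then show ?thesis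
    proof (induction rule: T.span_induct_alt)
      case (step c z y)
      then obtain x where z: "z = \<tau> x" by auto
      have "g z = - (\<Sum>c\<in>?K. sT (c ^ ?m) (\<gamma> (lift c) z))"
        unfolding z g \<gamma> proj_def \<tau>.minus \<tau>.sum \<tau>_scale
        using power_pred_idx[OF _ _ i] by (intro arg_cong[of _ _ uminus] sum.cong) auto
      then show ?case
        using step by (simp add: g.add g.scale \<gamma>.add \<gamma>.scale T.scale_right_distrib sum.distrib
            T.scale_sum_right mult.commute)
    qed simp
  qed
  show ?thesis
  proof
    show "V (proj i x) = g (V x)" for x
      unfolding g_eq proj_def using act_V[OF hom \<gamma>] by (simp add: V.neg V.sum V.scale)
    show "F (g y) = proj i (F y)" for y
      unfolding g_eq proj_def using act_F[OF hom \<gamma>] by (simp add: F.neg F.sum F.scale)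
  qed (use g in auto)
qed

text \<open>The projectors on \<open>E\<close> and \<open>T\<close> cut the exactness relations
  between \<open>F\<close> and \<open>V\<close>, and the description of \<open>range V\<close> by
  \<open>\<omega>\<close>, down to the part of index \<open>i\<close> and its counterpart in
  \<open>T\<close>, the twist of the part of index \<open>i - 1\<close>.\<close>

lemma
  assumes i: "i < f"
  shows V_image_part: "V ` part i = twist (hodge (pred_idx i))"
    and F_part: "\<And>y. y \<in> twist (part (pred_idx i)) \<Longrightarrow> F y \<in> part i"
    and V_kernel_part: "{x \<in> part i. V x = 0} = F ` twist (part (pred_idx i))"
    and F_hodge: "\<And>y. y \<in> twist (hodge (pred_idx i)) \<Longrightarrow> F y = 0"
proof -
  let ?i = "pred_idx i"
  note i' = pred_idx_less[OF i]
  obtain g where g: "module_hom sT sT g" "\<And>x. g (\<tau> x) = \<tau> (proj ?i x)"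
    "\<And>x. V (proj i x) = g (V x)" "\<And>y. F (g y) = proj i (F y)"
    using twisted_projection[OF i] by blast
  interpret g: module_hom sT sT g by (rule g)
  have g_id: "g y = y" if "y \<in> twist (part ?i)" for y
    using that
  proof (induction rule: T.span_induct_alt)
    case (step c z y)
    then show ?case using proj_on_part[OF i' i'] by (auto simp: g.add g.scale g(2))
  qed simp
  have g_part: "g y \<in> twist (part ?i)" for y
  proof -
    have \<tau>_proj: "\<tau> (proj ?i x) \<in> twist (part ?i)" for x
      by (intro T.span_base imageI proj_in_part[OF i'])
    have "y \<in> twist UNIV" using twist_UNIV by simp
    then show ?thesis
      by (induction rule: T.span_induct_alt)
        (auto simp: g.add g.scale g(2) T.span_zero intro!: T.span_add T.span_scale \<tau>_proj)
  qed
  have g_hodge: "g y \<in> twist (hodge ?i)" if "y \<in> range V" for y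
  proof -
    have \<tau>_proj: "\<tau> (proj ?i x) \<in> twist (hodge ?i)" if "x \<in> \<omega>" for x
      using proj_\<omega>[OF that] proj_in_part[OF i']
      by (intro T.span_base imageI) (simp add: hodge_def)
    have "y \<in> twist \<omega>" using that hodge_twist by simp
    then show ?thesis
      by (induction rule: T.span_induct_alt)
        (auto simp: g.add g.scale g(2) T.span_zero intro!: T.span_add T.span_scale \<tau>_proj)
  qed
  have sub: "twist (hodge ?i) \<subseteq> twist (part ?i)" "twist (hodge ?i) \<subseteq> range V"
    unfolding hodge_twist by (intro T.span_mono image_mono; simp add: hodge_def)+
  have x_id: "proj i x = x" if "x \<in> part i" for x
    using that proj_on_part[OF i i] by simp
  show "V ` part i = twist (hodge ?i)"
  proof
    show "V ` part i \<subseteq> twist (hodge ?i)"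
      using g(3) x_id g_hodge by (metis image_subsetI rangeI)
    show "twist (hodge ?i) \<subseteq> V ` part i"
    proof
      fix y assume y: "y \<in> twist (hodge ?i)"
      then obtain x where "y = V x" using sub by blast
      then have "y = V (proj i x)" using g(3) g_id sub y by auto
      then show "y \<in> V ` part i" using proj_in_part[OF i] by blast
    qed
  qed
  show F_part: "F y \<in> part i" if "y \<in> twist (part ?i)" for y
    using g(4)[of y] g_id[OF that] proj_in_part[OF i] by metis
  show "{x \<in> part i. V x = 0} = F ` twist (part ?i)"
  proof
    show "{x \<in> part i. V x = 0} \<subseteq> F ` twist (part ?i)"
    proof
      fix x assume x: "x \<in> {x \<in> part i. V x = 0}"
      then obtain y where "x = F y" using ker_V by blast
      then have "x = F (g y)" using g(4) x_id x by simp
      then show "x \<in> F ` twist (part ?i)" using g_part by blast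
    qed
    show "F ` twist (part ?i) \<subseteq> {x \<in> part i. V x = 0}"
      using F_part ker_V by blast
  qed
  show "F y = 0" if "y \<in> twist (hodge ?i)" for y
    using that sub ker_F by blast
qed

section \<open>Ranks of the parts\<close>

text \<open>The parts span \<open>E\<close> since the projections sum to the identity, so a basis
  can be chosen inside their union; projecting its combinations shows that its members in one part
  span that part.\<close>

lemma basis_of_parts:
  obtains B where "is_basis sE UNIV B" "finite B" "card B = f * h"
    "B \<subseteq> (\<Union>i<f. part i)" "\<And>i. i < f \<Longrightarrow> is_basis sE (part i) (B \<inter> part i)"
proof -
  have "x \<in> E.span (\<Union>i<f. part i)" for x
    by (subst sum_proj[of x, symmetric]) (auto intro!: E.span_sum intro: E.span_base proj_in_part)
  then have "E.span (\<Union>i<f. part i) = UNIV" by blast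
  moreover obtain B0 where "finite B0" "is_basis sE UNIV B0" "card B0 = f * h"
    using E_free by (auto simp: free_of_rank_def)
  ultimately obtain B where B: "B \<subseteq> (\<Union>i<f. part i)" "finite B" "card B = f * h" "is_basis sE UNIV B"
    using CE.steinitz by metis
  have "is_basis sE (part i) (B \<inter> part i)" if i: "i < f" for i
  proof -
    have span_proj: "proj i x \<in> E.span (B \<inter> part i)" if "x \<in> E.span B" for x
      using that
    proof (induction rule: E.span_induct_alt)
      case (step c b y)
      obtain j where "j < f" "b \<in> part j" using B step by auto
      then have "proj i b \<in> E.span (B \<inter> part i)"
        using proj_on_part[OF i] step by (auto simp: E.span_zero intro: E.span_base)
      then show ?case
        using step by (simp add: proj_add proj_scale E.span_add E.span_scale)
    qed (simp add: E.span_zero)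
    have "part i \<subseteq> E.span (B \<inter> part i)"
    proof
      fix x assume "x \<in> part i"
      then have "proj i x = x" using proj_on_part[OF i i] by simp
      moreover have "x \<in> E.span B" using B by (simp add: is_basis_def)
      ultimately show "x \<in> E.span (B \<inter> part i)"
        using span_proj[of x] by simp
    qed
    moreover have "E.span (B \<inter> part i) \<subseteq> part i"
      using part_subspace by (intro E.span_minimal) auto
    ultimately show ?thesis
      using B E.independent_mono[of B "B \<inter> part i"] by (auto simp: is_basis_def)
  qed
  then show ?thesis using that B by blast
qed

lemma part_disjoint:
  assumes "i < f" "j < f" "i \<noteq> j" "x \<in> part i" "x \<in> part j"
  shows "x = 0"
  using proj_on_part[OF assms(1,2,5)] proj_on_part[OF assms(1,1,4)] assms by simp

text \<open>
  A basis of the part of index \<open>i - 1\<close> adapted to the Hodge filtration is transported to the part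
  of index \<open>i\<close> by lifting the vectors of the Hodge filtration along \<open>V\<close> and pushing the other ones
  along \<open>F\<close>.
\<close>

lemma transported_generators:
  assumes i: "i < f" and H: "is_basis sE (hodge (pred_idx i)) H"
    and HD: "is_basis sE (part (pred_idx i)) (H \<union> D)" "H \<inter> D = {}"
  shows "\<exists>w. E.span (w ` (H \<union> D)) = part i \<and>
    (\<forall>A\<subseteq>H. {x \<in> part i. V x \<in> twist A} = E.span (w ` (A \<union> D))) \<and>
    (\<forall>D'\<subseteq>D. F ` twist (H \<union> D') = E.span (w ` D'))"
proof -
  let ?i = "pred_idx i"
  have spH: "E.span H = hodge ?i" and spHD: "E.span (H \<union> D) = part ?i"
    using H HD by (auto simp: is_basis_def)
  have tH: "twist (hodge ?i) = twist H" and tHD: "twist (part ?i) = twist (H \<union> D)"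
    using twist_span[of H] twist_span[of "H \<union> D"] by (simp_all add: spH spHD)
  have "\<exists>u. \<forall>b\<in>H. u b \<in> part i \<and> V (u b) = \<tau> b"
  proof (intro bchoice ballI)
    fix b assume "b \<in> H"
    then have "\<tau> b \<in> V ` part i"
      using V_image_part[OF i] tH by (auto intro: T.span_base)
    then show "\<exists>x. x \<in> part i \<and> V x = \<tau> b" by auto
  qed
  then obtain u where u: "\<And>b. b \<in> H \<Longrightarrow> u b \<in> part i" "\<And>b. b \<in> H \<Longrightarrow> V (u b) = \<tau> b" by blast
  define w where "w b = (if b \<in> H then u b else F (\<tau> b))" for b
  have wD: "w b = F (\<tau> b)" if "b \<in> D" for b using that HD(2) by (auto simp: w_def)
  have wD_part: "w b \<in> part i" "V (w b) = 0" if "b \<in> D" for b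
  proof -
    have "w b \<in> F ` twist (part ?i)" using that by (auto simp: wD tHD intro!: imageI T.span_base)
    then show "w b \<in> part i" "V (w b) = 0" using V_kernel_part[OF i] by blast+
  qed
  have wH: "w b \<in> part i" "V (w b) = \<tau> b" if "b \<in> H" for b
    using u that by (auto simp: w_def)
  have F_eq: "F ` twist (H \<union> D') = E.span (w ` D')" if D': "D' \<subseteq> D" for D'
  proof -
    have "F ` twist (H \<union> D') = E.span (F ` \<tau> ` (H \<union> D'))" by (rule F.span_image[symmetric])
    also have "w ` D' = F ` \<tau> ` D'"
      using wD D' by (auto simp: image_image intro!: image_cong)
    then have "F ` \<tau> ` (H \<union> D') = F ` \<tau> ` H \<union> w ` D'"
      by (simp add: image_Un)
    also have "E.span (F ` \<tau> ` H \<union> w ` D') = E.span (w ` D')"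
    proof -
      have "F (\<tau> b) = 0" if "b \<in> H" for b
        using F_hodge[OF i] that tH by (auto intro: T.span_base)
      then show ?thesis
        by (subst E.span_eq) (auto intro: E.span_base simp: E.span_zero)
    qed
    finally show ?thesis .
  qed
  have V_eq: "{x \<in> part i. V x \<in> twist A} = E.span (w ` (A \<union> D))" if A: "A \<subseteq> H" for A
  proof
    show "E.span (w ` (A \<union> D)) \<subseteq> {x \<in> part i. V x \<in> twist A}"
    proof (rule E.span_minimal)
      show "E.subspace {x \<in> part i. V x \<in> twist A}"
        using E.subspace_inter[OF part_subspace V.subspace_linear_preimage[OF T.subspace_span]]
        by (simp add: Collect_conj_eq)
      show "w ` (A \<union> D) \<subseteq> {x \<in> part i. V x \<in> twist A}"
        using wH wD_part A by (auto simp: T.span_zero subset_iff intro: T.span_base)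
    qed
    show "{x \<in> part i. V x \<in> twist A} \<subseteq> E.span (w ` (A \<union> D))"
    proof
      fix x assume x: "x \<in> {x \<in> part i. V x \<in> twist A}"
      \<comment> \<open>\<open>V x\<close> is also reached from the lifts of \<open>A\<close>; the
        two preimages differ by a vector of \<open>part i\<close> killed by \<open>V\<close>, and
        such vectors are spanned by those pushed along \<open>F\<close>.\<close>
      have "\<tau> ` A = V ` w ` A" using wH A by (force simp: image_iff)
      then have "V x \<in> V ` E.span (w ` A)" using x V.span_image[of "w ` A"] by simp
      then obtain z where z: "z \<in> E.span (w ` A)" "V x = V z" by auto
      have "E.span (w ` A) \<subseteq> part i"
        using wH A part_subspace by (intro E.span_minimal) auto
      then have "x - z \<in> {x \<in> part i. V x = 0}"
        using x z part_subspace by (auto simp: V.diff intro: E.subspace_diff)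
      then have "x - z \<in> E.span (w ` D)"
        using V_kernel_part[OF i] tHD F_eq[of D] by simp
      then have "z + (x - z) \<in> E.span (w ` (A \<union> D))"
        using z E.span_mono[of "w ` A" "w ` (A \<union> D)"] E.span_mono[of "w ` D" "w ` (A \<union> D)"]
        by (intro E.span_add) auto
      then show "x \<in> E.span (w ` (A \<union> D))" by simp
    qed
  qed
  have "{x \<in> part i. V x \<in> twist H} = part i"
    using V_image_part[OF i] tH by auto
  then have "E.span (w ` (H \<union> D)) = part i" using V_eq[of H] by simp
  then show ?thesis using F_eq V_eq by blast
qed

text \<open>Going once round the cycle returns to the starting value, so every inequality is an
  equality.\<close>

lemma cyclic_antimono_constant:
  fixes n :: "nat \<Rightarrow> nat"
  assumes "\<And>i. i < f \<Longrightarrow> n i \<le> n (pred_idx i)" "i < f"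
  shows "n i = n 0"
proof -
  have le: "n (i + k) \<le> n i" if "i + k < f" for i k
    using that
  proof (induction k)
    case (Suc k)
    then show ?case using assms(1)[of "i + Suc k"] by (simp add: pred_idx_def)
  qed simp
  have "n 0 \<le> n (f - 1)" using assms(1)[of 0] f_pos by (simp add: pred_idx_def)
  moreover have "n (f - 1) \<le> n i" using le[of i "f - 1 - i"] assms by simp
  moreover have "n i \<le> n 0" using le[of 0 i] assms by simp
  ultimately show ?thesis by simp
qed

lemma part_free:
  assumes "i < f"
  shows "free_of_rank sE (part i) h"
proof -
  obtain B where B: "is_basis sE UNIV B" "finite B" "card B = f * h"
    "B \<subseteq> (\<Union>i<f. part i)" "\<And>i. i < f \<Longrightarrow> is_basis sE (part i) (B \<inter> part i)"
    using basis_of_parts by blast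
  let ?n = "\<lambda>i. card (B \<inter> part i)"
  have free: "free_of_rank sE (part i) (?n i)" if "i < f" for i
    using B(2) B(5)[OF that] by (auto simp: free_of_rank_def)
  have "?n i \<le> ?n (pred_idx i)" if i: "i < f" for i
  proof -
    obtain H D where HD: "finite H" "finite D" "H \<inter> D = {}" "is_basis sE (hodge (pred_idx i)) H"
      "is_basis sE (part (pred_idx i)) (H \<union> D)" "card H + card D = ?n (pred_idx i)"
      using CE.direct_factor_bases[OF hodge_direct_factor_part free, OF pred_idx_less pred_idx_less, OF i i] .
    obtain w where w: "E.span (w ` (H \<union> D)) = part i"
      using transported_generators[OF i HD(4,5,3)] by (elim exE conjE) (rule that)
    then obtain B' where B': "B' \<subseteq> w ` (H \<union> D)" "card B' = ?n i"
      using CE.steinitz[OF _ B(5)[OF i] w] B(2) by auto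
    then have "?n i \<le> card (w ` (H \<union> D))" using HD by (metis card_mono finite_UnI finite_imageI)
    also have "\<dots> \<le> card (H \<union> D)" using HD by (intro card_image_le) auto
    also have "\<dots> = ?n (pred_idx i)" using HD by (simp add: card_Un_disjoint)
    finally show ?thesis .
  qed
  then have eq: "?n j = ?n 0" if "j < f" for j
    using cyclic_antimono_constant[of ?n] that by blast
  have "B = (\<Union>i<f. B \<inter> part i)" using B(4) by auto
  then have "f * h = card (\<Union>i<f. B \<inter> part i)" using B(3) by simp
  also have "\<dots> = (\<Sum>i<f. ?n i)"
  proof (rule card_UN_disjoint)
    have "0 \<notin> B" using B(1) E.dependent_zero by (auto simp: is_basis_def)
    then show "\<forall>i\<in>{..<f}. \<forall>j\<in>{..<f}. i \<noteq> j \<longrightarrow> B \<inter> part i \<inter> (B \<inter> part j) = {}"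
      using part_disjoint by fastforce
  qed (use B(2) in auto)
  also have "\<dots> = (\<Sum>i<f. ?n 0)" by (rule sum.cong[OF refl], rule eq) simp
  also have "\<dots> = f * ?n 0" by simp
  finally have "?n i = h" using eq[OF assms] f_pos by simp
  then show ?thesis using free[OF assms] by simp
qed

lemma hodge_free:
  assumes "i < f"
  shows "free_of_rank sE (hodge i) (d i)"
proof -
  obtain n where "free_of_rank sE (hodge i) n"
    using CE.direct_factor_bases[OF hodge_direct_factor_part[OF assms] part_free[OF assms]]
    by (metis free_of_rank_def)
  then show ?thesis using CE.free_rank_eq by (auto simp: d_def)
qed

lemma d_le: "i < f \<Longrightarrow> d i \<le> h"
  using CE.direct_factor_rank_le[OF hodge_direct_factor_part part_free hodge_free] by blast

section \<open>Transport of direct factors along \<open>V\<close> and \<open>F\<close>\<close>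

lemma transported_basis:
  assumes i: "i < f" and H: "is_basis sE (hodge (pred_idx i)) H"
    and HD: "is_basis sE (part (pred_idx i)) (H \<union> D)" "H \<inter> D = {}"
  shows "\<exists>w. is_basis sE (part i) (w ` (H \<union> D)) \<and> inj_on w (H \<union> D) \<and>
    (\<forall>A\<subseteq>H. {x \<in> part i. V x \<in> twist A} = E.span (w ` (A \<union> D))) \<and>
    (\<forall>D'\<subseteq>D. F ` twist (H \<union> D') = E.span (w ` D'))"
proof -
  obtain w where w: "E.span (w ` (H \<union> D)) = part i"
    "\<forall>A\<subseteq>H. {x \<in> part i. V x \<in> twist A} = E.span (w ` (A \<union> D))"
    "\<forall>D'\<subseteq>D. F ` twist (H \<union> D') = E.span (w ` D')"
    using transported_generators[OF assms] by (elim exE conjE) (rule that)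
  have fin: "finite (H \<union> D)" "card (H \<union> D) = h"
    using CE.basis_finite_card[OF part_free HD(1)] pred_idx_less[OF i] by auto
  then have "card (w ` (H \<union> D)) \<le> h" using card_image_le by metis
  then have "is_basis sE (part i) (w ` (H \<union> D))" "card (w ` (H \<union> D)) = h"
    using CE.spanning_card_le_basis[OF part_free[OF i] _ w(1)] fin by auto
  moreover from this have "inj_on w (H \<union> D)"
    using fin by (intro eq_card_imp_inj_on) auto
  ultimately show ?thesis using w(2,3) by blast
qed

lemma direct_factor_image_subset:
  assumes "is_basis sE P (w ` X)" "inj_on w X" "finite X" "Y \<subseteq> X"
  shows "direct_factor sE (E.span (w ` Y)) P" "free_of_rank sE (E.span (w ` Y)) (card Y)"
proof -
  have un: "w ` Y \<union> w ` (X - Y) = w ` X" using assms by auto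
  have ind: "E.independent (w ` X)" "E.span (w ` X) = P" using assms by (auto simp: is_basis_def)
  have "w ` Y \<inter> w ` (X - Y) = {}" using assms by (auto simp: inj_on_def)
  then show "direct_factor sE (E.span (w ` Y)) P"
    using E.direct_factor_span[of "w ` Y" "w ` (X - Y)"] ind by (simp add: un)
  have "card (w ` Y) = card Y" using assms by (meson card_image inj_on_subset)
  moreover have "finite (w ` Y)" using assms finite_subset by blast
  ultimately show "free_of_rank sE (E.span (w ` Y)) (card Y)"
    using CE.free_of_rank_span[of "w ` Y"] E.independent_mono[OF ind(1), of "w ` Y"] assms by auto
qed

text \<open>With bases \<open>A\<close>, \<open>A \<union> C\<close> and
  \<open>A \<union> C \<union> D\<close> of \<open>X\<close>, of the Hodge piece and of the part,
  the preimage has as basis the transports of \<open>A\<close> and \<open>D\<close>, those of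
  \<open>D\<close> spanning the kernel of \<open>V\<close>.\<close>

lemma V_preimage_direct_factor:
  assumes i: "i < f" and X: "direct_factor sE X (part (pred_idx i))" "free_of_rank sE X k"
    and sub: "X \<subseteq> hodge (pred_idx i)"
  shows "direct_factor sE {x \<in> part i. V x \<in> twist X} (part i)"
    "free_of_rank sE {x \<in> part i. V x \<in> twist X} (k + h - d (pred_idx i))"
proof -
  let ?i = "pred_idx i"
  note i' = pred_idx_less[OF i]
  have df: "direct_factor sE X (hodge ?i)"
    by (rule E.direct_factor_between[OF X(1) sub hodge_subspace hodge_subset_part])
  obtain A C where AC: "finite A" "finite C" "A \<inter> C = {}" "is_basis sE X A"
    "is_basis sE (hodge ?i) (A \<union> C)" "card A + card C = d ?i"
    using CE.direct_factor_bases[OF df hodge_free[OF i']] .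
  obtain D where D: "finite D" "(A \<union> C) \<inter> D = {}" "is_basis sE (part ?i) (A \<union> C \<union> D)"
    "card (A \<union> C) + card D = h"
    using CE.direct_factor_extend_basis[OF hodge_direct_factor_part[OF i'] part_free[OF i'] AC(5)] .
  obtain w where w: "is_basis sE (part i) (w ` (A \<union> C \<union> D))" "inj_on w (A \<union> C \<union> D)"
    "\<forall>Y\<subseteq>A \<union> C. {x \<in> part i. V x \<in> twist Y} = E.span (w ` (Y \<union> D))"
    using transported_basis[OF i AC(5) D(3,2)] by (elim exE conjE) (rule that)
  have "twist X = twist A" using AC(4) twist_span[of A] by (simp add: is_basis_def)
  then have eq: "{x \<in> part i. V x \<in> twist X} = E.span (w ` (A \<union> D))" using w(3) by simp
  have kA: "card A = k" using CE.basis_finite_card[OF X(2) AC(4)] by simp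
  have "A \<inter> D = {}" using D by blast
  then have "card (A \<union> D) = card A + card D" "card (A \<union> C) = card A + card C"
    using AC D by (simp_all add: card_Un_disjoint)
  then have "card (A \<union> D) = k + h - d ?i" using AC(6) D(4) kA by simp
  then show "direct_factor sE {x \<in> part i. V x \<in> twist X} (part i)"
    "free_of_rank sE {x \<in> part i. V x \<in> twist X} (k + h - d ?i)"
    using direct_factor_image_subset[OF w(1,2), of "A \<union> D"] AC D by (auto simp: eq)
qed

text \<open>With bases \<open>H\<close>, \<open>H \<union> C\<close> and
  \<open>H \<union> C \<union> D\<close> of the Hodge piece, of \<open>X\<close> and of the part,
  \<open>F\<close> kills what comes from \<open>H\<close>, so the image has as basis the transports
  of \<open>C\<close>.\<close>

lemma F_image_direct_factor:
  assumes i: "i < f" and X: "direct_factor sE X (part (pred_idx i))" "free_of_rank sE X k"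
    and sub: "hodge (pred_idx i) \<subseteq> X"
  shows "direct_factor sE (F ` twist X) (part i)"
    "free_of_rank sE (F ` twist X) (k - d (pred_idx i))"
proof -
  let ?i = "pred_idx i"
  note i' = pred_idx_less[OF i]
  have df: "direct_factor sE (hodge ?i) X"
    using X E.direct_factor_subspace E.direct_factor_subset sub
    by (intro E.direct_factor_between[OF hodge_direct_factor_part[OF i']]) auto
  obtain H C where HC: "finite H" "finite C" "H \<inter> C = {}" "is_basis sE (hodge ?i) H"
    "is_basis sE X (H \<union> C)" "card H + card C = k"
    using CE.direct_factor_bases[OF df X(2)] .
  obtain D where D: "finite D" "(H \<union> C) \<inter> D = {}" "is_basis sE (part ?i) (H \<union> C \<union> D)"
    "card (H \<union> C) + card D = h"
    using CE.direct_factor_extend_basis[OF X(1) part_free[OF i'] HC(5)] .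
  have HD: "is_basis sE (part ?i) (H \<union> (C \<union> D))" "H \<inter> (C \<union> D) = {}"
    using D HC by (auto simp: Un_assoc)
  obtain w where w: "is_basis sE (part i) (w ` (H \<union> (C \<union> D)))" "inj_on w (H \<union> (C \<union> D))"
    "\<forall>D'\<subseteq>C \<union> D. F ` twist (H \<union> D') = E.span (w ` D')"
    using transported_basis[OF i HC(4) HD] by (elim exE conjE) (rule that)
  have "twist X = twist (H \<union> C)" using HC(5) twist_span[of "H \<union> C"] by (simp add: is_basis_def)
  then have eq: "F ` twist X = E.span (w ` C)" using w(3) by simp
  have "card H = d ?i" using CE.basis_finite_card[OF hodge_free[OF i'] HC(4)] by simp
  then have "card C = k - d ?i" using HC by simp
  then show "direct_factor sE (F ` twist X) (part i)"
    "free_of_rank sE (F ` twist X) (k - d ?i)"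
    using direct_factor_image_subset[OF w(1,2), of C] HC D by (auto simp: eq)
qed

section \<open>Adequate filtrations\<close>

text \<open>The choices are made one index after the other, starting at \<open>i0\<close>. The
  relation is not claimed at \<open>i0\<close>, where the cycle closes.\<close>

lemma cyclic_choice:
  assumes i0: "i0 < f" "ok i0 X0"
    and ex: "\<And>i X. i < f \<Longrightarrow> ok (pred_idx i) X \<Longrightarrow> \<exists>Y. ok i Y \<and> R i X Y"
  shows "\<exists>G. \<forall>i<f. ok i (G i) \<and> (i \<noteq> i0 \<longrightarrow> R i (G (pred_idx i)) (G i))"
proof -
  \<comment> \<open>\<open>idx t\<close> is the index \<open>t\<close> steps after
    \<open>i0\<close>, and \<open>k i\<close> below counts the steps from \<open>i0\<close> to
    \<open>i\<close>; of the infinite sequence \<open>g\<close> only the first \<open>f\<close>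
    terms are kept.\<close>
  define idx where "idx t = (i0 + t) mod f" for t
  have idx_less: "idx t < f" for t using f_pos by (simp add: idx_def)
  have pred: "pred_idx (idx (Suc t)) = idx t" for t
    using f_pos by (auto simp: idx_def pred_idx_def mod_Suc)
  have "\<exists>g. \<forall>t. ok (idx t) (g t) \<and> R (idx (Suc t)) (g t) (g (Suc t))"
  proof (rule dependent_nat_choice)
    show "\<exists>X. ok (idx 0) X" using i0 by (auto simp: idx_def)
    show "\<exists>Y. ok (idx (Suc t)) Y \<and> R (idx (Suc t)) X Y" if "ok (idx t) X" for X t
      using ex[OF idx_less, of "Suc t" X] that by (simp add: pred)
  qed
  then obtain g where g: "\<And>t. ok (idx t) (g t)" "\<And>t. R (idx (Suc t)) (g t) (g (Suc t))" by blast
  define k where "k i = (if i0 \<le> i then i - i0 else i + f - i0)" for i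
  have idx_k: "idx (k i) = i" if "i < f" for i
    using that i0 by (auto simp: idx_def k_def)
  have k_Suc: "k i = Suc (k (pred_idx i))" if "i < f" "i \<noteq> i0" for i
    using that i0 by (auto simp: k_def pred_idx_def)
  have "ok i (g (k i)) \<and> (i \<noteq> i0 \<longrightarrow> R i (g (k (pred_idx i))) (g (k i)))" if i: "i < f" for i
    using g(1)[of "k i"] g(2)[of "k (pred_idx i)"] idx_k[OF i] k_Suc[OF i] by auto
  then show ?thesis by (intro exI[of _ "\<lambda>i. g (k i)"]) blast
qed

section \<open>The ranks \<open>\<delta>\<close> and the indices \<open>s\<close> in positive
  height\<close>

context
  assumes h_pos: "0 < h"
begin

lemma \<Delta>_bounds: "x \<in> \<Delta> \<Longrightarrow> 0 < x \<and> x < h"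
  using h_pos by (auto simp: \<Delta>_def)

lemma finite_\<Delta>: "finite \<Delta>"
  by (simp add: \<Delta>_def)

lemma \<delta>_less:
  assumes "j < k" "k \<le> r + 1"
  shows "\<delta> j < \<delta> k"
proof -
  have "sorted_wrt (<) (0 # sorted_list_of_set \<Delta> @ [h])"
    using h_pos \<Delta>_bounds finite_\<Delta> by (auto simp: sorted_wrt_append)
  then show ?thesis
    unfolding \<delta>_def using assms by (elim sorted_wrt_nth_less) (simp_all add: r_def)
qed

lemma \<delta>_le: "j \<le> k \<Longrightarrow> k \<le> r + 1 \<Longrightarrow> \<delta> j \<le> \<delta> k"
  using \<delta>_less[of j k] by (cases "j = k") auto

lemma \<delta>_0: "\<delta> 0 = 0"
  by (simp add: \<delta>_def)

lemma \<delta>_le_h: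
  assumes "j \<le> r + 1"
  shows "\<delta> j \<le> h"
proof -
  have "\<delta> (r + 1) = h" by (simp add: \<delta>_def nth_append r_def)
  then show ?thesis using \<delta>_le[OF assms] by simp
qed

lemma s_unique: "j \<le> r + 1 \<Longrightarrow> \<delta> j = d i \<Longrightarrow> s i = j"
  unfolding s_def
proof (rule the_equality)
  fix k assume "j \<le> r + 1" "\<delta> j = d i" "k \<le> r + 1 \<and> \<delta> k = d i"
  then show "k = j" using \<delta>_less[of j k] \<delta>_less[of k j] by (cases j k rule: linorder_cases) auto
qed simp

lemma s_properties:
  assumes "i < f"
  shows "s i \<le> r + 1" "\<delta> (s i) = d i"
proof -
  have "d i \<in> set (0 # sorted_list_of_set \<Delta> @ [h])"
    using d_le[OF assms] assms finite_\<Delta> by (auto simp: \<Delta>_def)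
  then obtain j where "j < length (0 # sorted_list_of_set \<Delta> @ [h])"
    "(0 # sorted_list_of_set \<Delta> @ [h]) ! j = d i"
    unfolding in_set_conv_nth by blast
  then have "j \<le> r + 1" "\<delta> j = d i" by (auto simp: \<delta>_def r_def)
  then show "s i \<le> r + 1" "\<delta> (s i) = d i" using s_unique by auto
qed

text \<open>Provides, for each \<open>j\<close>, an index where the submodule is zero and the
  construction can start.\<close>

lemma s_surj:
  assumes "1 \<le> j" "j \<le> r"
  shows "\<exists>i<f. s i = j"
proof -
  have "\<delta> j = sorted_list_of_set \<Delta> ! (j - 1)"
    using assms by (cases j) (auto simp: \<delta>_def nth_append r_def)
  also have "\<dots> \<in> set (sorted_list_of_set \<Delta>)"
    using assms by (intro nth_mem) (simp add: r_def)
  finally have "\<delta> j \<in> \<Delta>" using finite_\<Delta> by simp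
  then obtain i where "i < f" "\<delta> j = d i" by (auto simp: \<Delta>_def)
  then show ?thesis using s_unique[of j i] assms by auto
qed

lemma \<delta>_le_d: "i < f \<Longrightarrow> j \<le> s i \<Longrightarrow> \<delta> j \<le> d i"
  using \<delta>_le[of j "s i"] s_properties[of i] by simp

lemma d_le_\<delta>: "i < f \<Longrightarrow> s i \<le> j \<Longrightarrow> j \<le> r + 1 \<Longrightarrow> d i \<le> \<delta> j"
  using \<delta>_le[of "s i" j] s_properties[of i] by simp

section \<open>Single steps and their transport\<close>

text \<open>The first branch covers \<open>j = s i\<close>: there the rank is 0, which forces the
  conventional value \<open>{0}\<close>.\<close>

definition step_ok :: "nat \<Rightarrow> nat \<Rightarrow> 'e set \<Rightarrow> bool" where
  "step_ok i j X \<longleftrightarrow> direct_factor sE X (part i) \<and>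
     (if j \<le> s i then free_of_rank sE X (d i - \<delta> j) \<and> X \<subseteq> hodge i
      else free_of_rank sE X (h + d i - \<delta> j) \<and> hodge i \<subseteq> X)"

definition transport :: "nat \<Rightarrow> nat \<Rightarrow> 'e set \<Rightarrow> 'e set" where
  "transport i j X = (if j \<le> s (pred_idx i) then {x \<in> part i. V x \<in> twist X} else F ` twist X)"

lemma tilde_eq: "tilde Fil i j = transport i j (step Fil (pred_idx i) j)"
  by (simp add: tilde_def transport_def)

lemma step_ok_zero: "i < f \<Longrightarrow> step_ok i (s i) {0}"
  using E.direct_factor_zero[OF part_subspace] E.subspace_0[OF hodge_subspace]
  by (simp add: step_ok_def s_properties CE.free_of_rank_zero)

lemma step_ok_at_s: "i < f \<Longrightarrow> step_ok i (s i) X \<Longrightarrow> X = {0}"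
  by (simp add: step_ok_def s_properties CE.free_of_rank_zero)

lemma step_ok_subset: "step_ok i j X \<Longrightarrow> X \<subseteq> part i"
  using E.direct_factor_subset by (auto simp: step_ok_def)

text \<open>With \<open>d'\<close> the Hodge rank at the previous index, the ranks are
  \<open>(d' - \<delta> j) + h - d'\<close> for the preimage and
  \<open>(h + d' - \<delta> j) - d'\<close> for the image, the same number.\<close>

lemma transport_direct_factor:
  assumes i: "i < f" and j: "j \<le> r" and X: "step_ok (pred_idx i) j X"
  shows "direct_factor sE (transport i j X) (part i)"
    "free_of_rank sE (transport i j X) (h - \<delta> j)"
proof -
  let ?i = "pred_idx i"
  note i' = pred_idx_less[OF i]
  have "direct_factor sE (transport i j X) (part i) \<and> free_of_rank sE (transport i j X) (h - \<delta> j)"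
  proof (cases "j \<le> s ?i")
    case True
    have "d ?i - \<delta> j + h - d ?i = h - \<delta> j"
      using \<delta>_le_d[OF i' True] d_le[OF i'] by simp
    then show ?thesis
      using V_preimage_direct_factor[OF i, of X "d ?i - \<delta> j"] X True
      by (simp add: step_ok_def transport_def)
  next
    case False
    have "h + d ?i - \<delta> j - d ?i = h - \<delta> j" by simp
    then show ?thesis
      using F_image_direct_factor[OF i, of X "h + d ?i - \<delta> j"] X False
      by (simp add: step_ok_def transport_def)
  qed
  then show "direct_factor sE (transport i j X) (part i)"
    "free_of_rank sE (transport i j X) (h - \<delta> j)" by auto
qed

text \<open>When \<open>j \<le> s (pred_idx i) < k\<close>, no relation between \<open>X\<close> and
  \<open>Y\<close> is assumed: the image of \<open>F\<close> lies in the kernel of \<open>V\<close>,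
  hence in the preimage of any submodule under \<open>V\<close>.\<close>

lemma transport_mono:
  assumes i: "i < f" and "j \<le> k" and Y: "Y \<subseteq> part (pred_idx i)"
    and YX: "k \<le> s (pred_idx i) \<or> s (pred_idx i) < j \<Longrightarrow> Y \<subseteq> X"
  shows "transport i k Y \<subseteq> transport i j X"
proof (cases "k \<le> s (pred_idx i) \<or> s (pred_idx i) < j")
  case True
  then have "twist Y \<subseteq> twist X" using YX by (intro T.span_mono image_mono)
  then show ?thesis using True assms(2) by (auto simp: transport_def)
next
  case False
  have "V (F y) = 0" for y using ker_V by blast
  moreover have "twist Y \<subseteq> twist (part (pred_idx i))"
    using Y by (intro T.span_mono image_mono)
  ultimately show ?thesis
    using False F_part[OF i] by (auto simp: transport_def T.span_zero)
qed

text \<open>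
  The restriction of adequacy to the steps of index at most \<open>J\<close>, completed by a step of index 0.
\<close>

definition adequate_upto :: "nat \<Rightarrow> (nat \<Rightarrow> nat \<Rightarrow> 'e set) \<Rightarrow> bool" where
  "adequate_upto J Fil \<longleftrightarrow> (\<forall>i<f.
     (\<forall>j\<le>J. j \<noteq> s i \<longrightarrow> step_ok i j (Fil i j)) \<and>
     (\<forall>j\<le>J. j < s i \<longrightarrow> Fil i j \<subseteq> tilde Fil i j) \<and>
     (\<forall>j\<le>J. s i < j \<longrightarrow> tilde Fil i j \<subseteq> Fil i j) \<and>
     (\<forall>j j'. j \<le> j' \<and> j' \<le> J \<and> (j' < s i \<or> s i < j) \<longrightarrow> Fil i j' \<subseteq> Fil i j))"

section \<open>Induction on the index of the steps, starting from the Hodge filtration\<close>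

lemma adequate_upto_step_ok:
  assumes "adequate_upto J Fil" "i < f" "j \<le> J"
  shows "step_ok i j (step Fil i j)"
  using assms step_ok_zero[of i] by (auto simp: adequate_upto_def step_def)

lemma adequate_upto_0: "adequate_upto 0 (\<lambda>i j. hodge i)"
proof -
  have ok: "step_ok i 0 (hodge i)" if "i < f" for i
    using that hodge_direct_factor_part hodge_free by (simp add: step_ok_def \<delta>_0)
  \<comment> \<open>If \<open>s i = 0\<close>, then \<open>hodge i\<close> has rank 0, in agreement
    with the convention that this step vanishes.\<close>
  have step_0: "step (\<lambda>i j. hodge i) i 0 = hodge i" if "i < f" for i
    using step_ok_at_s[OF that, of "hodge i"] ok[OF that] by (auto simp: step_def)
  have "hodge i \<subseteq> tilde (\<lambda>i j. hodge i) i 0" if "i < f" for i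
  proof -
    have "V x \<in> twist (hodge (pred_idx i))" if "x \<in> hodge i" for x
      using that V_image_part[OF \<open>i < f\<close>] hodge_subset_part[of i] by blast
    then show ?thesis
      using step_0[OF pred_idx_less[OF that]] hodge_subset_part[of i]
      by (auto simp: tilde_def)
  qed
  then show ?thesis using ok by (simp add: adequate_upto_def)
qed

lemma extend_step:
  assumes Fil: "adequate_upto J Fil" and J: "Suc J \<le> r" and i: "i < f" and si: "s i \<noteq> Suc J"
    and X: "step_ok (pred_idx i) (Suc J) X"
    and XJ: "s (pred_idx i) \<noteq> J \<Longrightarrow> X \<subseteq> Fil (pred_idx i) J"
  shows "\<exists>Y. step_ok i (Suc J) Y \<and> (s i \<noteq> J \<longrightarrow> Y \<subseteq> Fil i J) \<and>
    (if Suc J < s i then Y \<subseteq> transport i (Suc J) X else transport i (Suc J) X \<subseteq> Y)"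
proof -
  let ?j = "Suc J" and ?W = "transport i (Suc J) X" and ?W' = "tilde Fil i J"
  note i' = pred_idx_less[OF i]
  have W: "direct_factor sE ?W (part i)" "free_of_rank sE ?W (h - \<delta> ?j)"
    using transport_direct_factor[OF i J X] by auto
  have W': "direct_factor sE ?W' (part i)" "free_of_rank sE ?W' (h - \<delta> J)"
    using transport_direct_factor[OF i _ adequate_upto_step_ok[OF Fil i' order_refl]] J
    by (auto simp: tilde_eq)
  \<comment> \<open>\<open>?W'\<close> is the ambient module when \<open>Suc J < s i\<close>, and it
    lies in \<open>Fil i J\<close> when \<open>s i < J\<close>.\<close>
  have WW': "?W \<subseteq> ?W'"
    unfolding tilde_eq
    using XJ by (intro transport_mono[OF i] step_ok_subset[OF X]) (auto simp: step_def)
  have U: "step_ok i J (Fil i J)" if "s i \<noteq> J"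
    using Fil i that by (auto simp: adequate_upto_def)
  have \<delta>: "\<delta> J \<le> \<delta> ?j" "\<delta> ?j \<le> h" using \<delta>_le[of J ?j] \<delta>_le_h[of ?j] J by auto
  consider "?j < s i" | "s i = J" | "s i < J" using si by linarith
  then show ?thesis
  proof cases
    case 1
    let ?U = "Fil i J"
    have U: "direct_factor sE ?U (part i)" "free_of_rank sE ?U (d i - \<delta> J)" "?U \<subseteq> hodge i"
      using U 1 by (auto simp: step_ok_def)
    have UW': "?U \<subseteq> ?W'" using Fil i 1 by (auto simp: adequate_upto_def)
    have W'P: "E.subspace ?W'" "?W' \<subseteq> part i"
      using W' E.direct_factor_subspace E.direct_factor_subset by auto
    have dj: "\<delta> ?j \<le> d i" using \<delta>_le_d[OF i, of ?j] 1 by simp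
    \<comment> \<open>The ranks of the two factors exceed that of the ambient \<open>?W'\<close> by
      \<open>d i - \<delta> (Suc J)\<close>, the rank wanted inside the intersection.\<close>
    then have "h - \<delta> J \<le> (d i - \<delta> J) + (h - \<delta> ?j)" using \<delta> by simp
    then obtain L where L: "direct_factor sE L ?W'"
      "free_of_rank sE L ((d i - \<delta> J) + (h - \<delta> ?j) - (h - \<delta> J))" "L \<subseteq> ?U \<inter> ?W"
      using CE.direct_factor_in_Int[OF W'(2) E.direct_factor_between[OF U(1) UW' W'P] U(2)
          E.direct_factor_between[OF W(1) WW' W'P] W(2)] by blast
    have "(d i - \<delta> J) + (h - \<delta> ?j) - (h - \<delta> J) = d i - \<delta> ?j" using \<delta> dj by simp
    then have "step_ok i ?j L"
      using L U(3) E.direct_factor_trans[OF L(1) W'(1)] 1 by (auto simp: step_ok_def)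
    then show ?thesis using L(3) 1 by auto
  next
    case 2
    \<comment> \<open>The chain has no submodule of index \<open>J\<close> here, so the ambient
      module is the whole part; this bound keeps the wanted rank at most \<open>h\<close>.\<close>
    have dj: "d i \<le> \<delta> ?j" using d_le_\<delta>[OF i, of ?j] 2 J by simp
    then have "d i + (h - \<delta> ?j) \<le> h + d i - \<delta> ?j" "h + d i - \<delta> ?j \<le> h" using \<delta> by linarith+
    then obtain L where L: "direct_factor sE L (part i)" "free_of_rank sE L (h + d i - \<delta> ?j)"
      "hodge i \<union> ?W \<subseteq> L"
      using CE.direct_factor_containing_Un[OF part_free[OF i] hodge_direct_factor_part[OF i]
          hodge_free[OF i] E.direct_factor_subset[OF W(1)] W(2)] by blast
    then have "step_ok i ?j L" using 2 by (simp add: step_ok_def)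
    then show ?thesis using L(3) 2 by auto
  next
    case 3
    let ?U = "Fil i J"
    have U: "direct_factor sE ?U (part i)" "free_of_rank sE ?U (h + d i - \<delta> J)" "hodge i \<subseteq> ?U"
      using U 3 by (auto simp: step_ok_def)
    have "?W' \<subseteq> ?U" using Fil i 3 by (auto simp: adequate_upto_def)
    then have WU: "?W \<subseteq> ?U" using WW' by blast
    have df: "direct_factor sE (hodge i) ?U"
      by (rule E.direct_factor_between[OF hodge_direct_factor_part[OF i] U(3)
            E.direct_factor_subspace[OF U(1)] E.direct_factor_subset[OF U(1)]])
    \<comment> \<open>The ranks of the Hodge piece and of \<open>?W\<close> add up to the wanted
      rank, which is at most that of \<open>?U\<close> since \<open>\<delta>\<close>
      increases.\<close>
    have "d i + (h - \<delta> ?j) \<le> h + d i - \<delta> ?j" "h + d i - \<delta> ?j \<le> h + d i - \<delta> J" using \<delta> by linarith+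
    then obtain L where L: "direct_factor sE L ?U" "free_of_rank sE L (h + d i - \<delta> ?j)"
      "hodge i \<union> ?W \<subseteq> L"
      using CE.direct_factor_containing_Un[OF U(2) df hodge_free[OF i] WU W(2)] by blast
    have "step_ok i ?j L"
      using L E.direct_factor_trans[OF L(1) U(1)] 3 by (auto simp: step_ok_def)
    then show ?thesis using L(3) E.direct_factor_subset[OF L(1)] 3 by auto
  qed
qed

text \<open>The cycle is cut at an index \<open>i0\<close> with \<open>s i0 = Suc J\<close>, where
  the submodule is zero and no inclusion is required, so nothing has to match when the cycle
  closes.\<close>

lemma adequate_upto_Suc:
  assumes Fil: "adequate_upto J Fil" and J: "Suc J \<le> r"
  shows "\<exists>Fil'. adequate_upto (Suc J) Fil'"
proof -
  let ?j = "Suc J"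
  define ok where "ok i X \<longleftrightarrow> step_ok i ?j X \<and> (s i \<noteq> J \<longrightarrow> X \<subseteq> Fil i J)" for i X
  define R where "R i X Y \<longleftrightarrow> s i \<noteq> ?j \<longrightarrow>
    (if ?j < s i then Y \<subseteq> transport i ?j X else transport i ?j X \<subseteq> Y)" for i X Y
  have ok_zero: "ok i {0}" if "i < f" "s i = ?j" for i
  proof -
    have "direct_factor sE (Fil i J) (part i)"
      using Fil that by (auto simp: adequate_upto_def step_ok_def)
    then have "0 \<in> Fil i J" using E.direct_factor_subspace E.subspace_0 by blast
    then show ?thesis using step_ok_zero[of i] that by (simp add: ok_def)
  qed
  obtain i0 where i0: "i0 < f" "s i0 = ?j" using s_surj[of ?j] J by auto
  have "\<exists>Y. ok i Y \<and> R i X Y" if "i < f" "ok (pred_idx i) X" for i X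
  proof (cases "s i = ?j")
    case True
    then show ?thesis using ok_zero that by (auto simp: R_def)
  next
    case False
    then show ?thesis
      using extend_step[OF Fil J that(1) False, of X] that(2) by (auto simp: ok_def R_def)
  qed
  then obtain G where G: "\<And>i. i < f \<Longrightarrow> ok i (G i)"
    "\<And>i. i < f \<Longrightarrow> i \<noteq> i0 \<Longrightarrow> R i (G (pred_idx i)) (G i)"
    using cyclic_choice[of i0 ok "{0}" R] i0 ok_zero by blast
  define Fil' where "Fil' i j = (if j = ?j then G i else Fil i j)" for i j
  have tilde_old: "tilde Fil' i j = tilde Fil i j" if "j \<le> J" for i j
    using that by (simp add: tilde_def step_def Fil'_def)
  \<comment> \<open>Where \<open>s\<close> takes the value \<open>Suc J\<close>, the chosen
    submodule has rank 0, so the convention in \<open>step\<close> changes nothing.\<close>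
  have tilde_new: "tilde Fil' i ?j = transport i ?j (G (pred_idx i))" if "i < f" for i
    using G(1)[OF pred_idx_less[OF that]] step_ok_at_s[OF pred_idx_less[OF that], of "G (pred_idx i)"]
    by (auto simp: tilde_eq step_def Fil'_def ok_def)
  have R: "R i (G (pred_idx i)) (G i)" if "i < f" for i
    using G(2)[OF that] i0 by (cases "i = i0") (auto simp: R_def)
  have "adequate_upto ?j Fil'"
    unfolding adequate_upto_def
  proof (intro allI impI conjI)
    fix i j assume i: "i < f" and j: "j \<le> ?j"
    show "step_ok i j (Fil' i j)" if "j \<noteq> s i"
      using that Fil i j G(1)[OF i] by (auto simp: adequate_upto_def Fil'_def ok_def le_Suc_eq)
    show "Fil' i j \<subseteq> tilde Fil' i j" if "j < s i"
    proof (cases "j = ?j")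
      case True
      then show ?thesis using R[OF i] that tilde_new[OF i] by (simp add: R_def Fil'_def)
    next
      case False
      then show ?thesis using Fil i j that tilde_old by (simp add: adequate_upto_def Fil'_def)
    qed
    show "tilde Fil' i j \<subseteq> Fil' i j" if "s i < j"
    proof (cases "j = ?j")
      case True
      then show ?thesis using R[OF i] that tilde_new[OF i] by (simp add: R_def Fil'_def)
    next
      case False
      then show ?thesis using Fil i j that tilde_old by (simp add: adequate_upto_def Fil'_def)
    qed
  next
    fix i j j' assume i: "i < f" and j: "j \<le> j' \<and> j' \<le> ?j \<and> (j' < s i \<or> s i < j)"
    have old: "Fil i k' \<subseteq> Fil i k" if "k \<le> k'" "k' \<le> J" "k' < s i \<or> s i < k" for k k'
      using Fil i that by (auto simp: adequate_upto_def)
    show "Fil' i j' \<subseteq> Fil' i j"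
    proof (cases "j' = ?j \<and> j \<noteq> ?j")
      case True
      \<comment> \<open>As \<open>j \<le> J\<close>, the side condition excludes
        \<open>s i = J\<close>, so the new submodule was chosen inside the one of index
        \<open>J\<close>.\<close>
      then have "s i \<noteq> J" "Fil i J \<subseteq> Fil i j" using j old[of j J] by auto
      then show ?thesis using True G(1)[OF i] by (auto simp: Fil'_def ok_def)
    next
      case False
      then show ?thesis using j old[of j j'] by (auto simp: Fil'_def)
    qed
  qed
  then show ?thesis by blast
qed

end

lemma adequate_exists: "\<exists>Fil. adequate Fil"
proof (cases "h = 0")
  case True
  \<comment> \<open>In height zero there are no steps to construct.\<close>
  have "\<Delta> = {}" unfolding \<Delta>_def by (subst True) simp
  then have "r = 0" by (simp add: r_def)
  then show ?thesis by (simp add: adequate_def)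
next
  case False
  then have h: "0 < h" by simp
  have "J \<le> r \<Longrightarrow> \<exists>Fil. adequate_upto J Fil" for J
  proof (induction J)
    case 0
    then show ?case using adequate_upto_0[OF h] by blast
  next
    case (Suc J)
    then show ?case using adequate_upto_Suc[OF h] by auto
  qed
  then obtain Fil where "adequate_upto r Fil" by blast
  then have "adequate Fil"
    unfolding adequate_def adequate_upto_def[OF h] step_ok_def[OF h]
    by auto
  then show ?thesis by blast
qed

end

section \<open>Verification of the graded setting: the image of \<open>\<phi>\<close> is the residue
  field\<close>

theorem theorem3p1p1:
  fixes p f h :: nat
    and \<phi> :: "'o::{idom,ring_char_0} \<Rightarrow> 'r::comm_ring_1"
    and sE :: "'r \<Rightarrow> 'e::ab_group_add \<Rightarrow> 'e"
    and sT :: "'r \<Rightarrow> 't::ab_group_add \<Rightarrow> 't"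
    and F :: "'t \<Rightarrow> 'e" and V :: "'e \<Rightarrow> 't"
    and \<tau> :: "'e \<Rightarrow> 't" and \<omega> :: "'e set"
    and act :: "'o \<Rightarrow> 'e \<Rightarrow> 'e"
  assumes "prime p" and "f \<ge> 1"
    and "unramified_integers p f TYPE('o)"
    and "residue_field_algebra p \<phi>"
    and "\<forall>x y :: 'r. x dvd y \<or> y dvd x"
    and "dieudonne_evaluation_action sE sT F V p f h \<tau> \<omega> act"
  shows "\<exists>Fil. dieudonne_evaluation_action.adequate sE sT F V p f h \<tau> \<omega> act \<phi> Fil"
proof -
  have \<phi>: "\<phi> 1 = 1" "\<And>a b. \<phi> (a + b) = \<phi> a + \<phi> b" "\<And>a b. \<phi> (a * b) = \<phi> a * \<phi> b"
    and \<phi>_p: "\<phi> (of_nat p) = 0"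
    using assms(4) by (auto simp: residue_field_algebra_def)
  have O: "a = 0 \<or> (\<exists>n u. u dvd 1 \<and> a = u * of_nat p ^ n)" for a :: 'o
    using assms(3) by (auto simp: unramified_integers_def)
  interpret \<phi>: additive \<phi> by unfold_locales (rule \<phi>(2))
  have unit_or_p_dvd: "a dvd 1 \<or> of_nat p dvd a" for a :: 'o
  proof (cases "a = 0")
    case False
    then obtain n u where "u dvd 1" "a = u * of_nat p ^ n" using O by blast
    then show ?thesis by (cases n) auto
  qed simp
  \<comment> \<open>A ring homomorphism to a nonzero ring cannot kill a unit, and every other
    element is a multiple of \<open>p\<close>.\<close>
  have kernel: "\<phi> a = 0 \<longleftrightarrow> of_nat p dvd a" for a
  proof
    assume a: "\<phi> a = 0"
    have "\<not> a dvd 1"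
    proof
      assume "a dvd 1"
      then obtain b where "1 = a * b" by (elim dvdE)
      then have "\<phi> 1 = \<phi> a * \<phi> b" using \<phi>(3) by metis
      then show False using a \<phi>(1) by simp
    qed
    then show "of_nat p dvd a" using unit_or_p_dvd by blast
  qed (auto simp: \<phi> \<phi>_p elim!: dvdE)
  have "card (range \<phi>) = p ^ f"
  proof -
    \<comment> \<open>The fibres of \<open>\<phi>\<close> are exactly the residue classes modulo
      \<open>p\<close>, whose number is known.\<close>
    let ?rel = "{(a :: 'o, b). of_nat p dvd a - b}"
    have rel: "?rel = {(a, b). \<phi> a = \<phi> b}"
      by (simp add: \<phi>.diff flip: kernel)
    have "?rel `` {a} = \<phi> -` {\<phi> a}" for a unfolding rel by auto
    then have quot: "(UNIV :: 'o set) // ?rel = (\<lambda>c. \<phi> -` {c}) ` range \<phi>"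
      unfolding quotient_def by blast
    have "inj_on (\<lambda>c. \<phi> -` {c}) (range \<phi>)" by (rule inj_onI) blast
    then have "card (range \<phi>) = card ((UNIV :: 'o set) // ?rel)"
      unfolding quot by (rule card_image[symmetric])
    then show ?thesis using assms(3) by (simp add: unramified_integers_def)
  qed
  moreover have "\<exists>y\<in>range \<phi>. x * y = 1" if x: "x \<in> range \<phi>" "x \<noteq> 0" for x
  proof -
    obtain a where a: "x = \<phi> a" using x by blast
    then have "a dvd 1" using x unit_or_p_dvd kernel by blast
    then obtain b where "1 = a * b" by (elim dvdE)
    then have "x * \<phi> b = 1" using a \<phi> by metis
    then show ?thesis by blast
  qed
  moreover have "of_nat p = (0 :: 'r)"
  proof -
    have "\<phi> (of_nat n) = of_nat n" for n
      by (induction n) (simp_all add: \<phi>.zero \<phi>)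
    then show ?thesis using \<phi>_p by metis
  qed
  moreover have "x + y \<in> range \<phi>" "x * y \<in> range \<phi>" if "x \<in> range \<phi>" "y \<in> range \<phi>" for x y
    using that by (auto simp flip: \<phi>)
  moreover have "1 \<in> range \<phi>" using \<phi>(1) by (metis rangeI)
  ultimately have "finite_subfield (range \<phi>) p f"
    using assms(1,2) by unfold_locales auto
  then interpret graded_dieudonne sE sT F V p f h \<tau> \<omega> act \<phi>
    using assms(5,6) \<phi> kernel
    by (intro graded_dieudonne.intro graded_dieudonne_axioms.intro) auto
  show ?thesis by (rule adequate_exists)
qed

end
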